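(* If $G=((A,B),E_G)$ is a connected $n$-vertex bipartite graph with partite sets $A$ and $B$ such that $1\le |A|\le |B|$, then the equality $\gamma(G)=|A|$ can be verified in $O(n^2)$ time; that is, there is a deterministic algorithm that, given such a graph, decides in $O(n^2)$ time whether $\gamma(G)=|A|$.
   Context: Graphs are finite, simple and undirected. $\gamma(G)$ is the domination number of $G$: the minimum cardinality of a set $D\subseteq V_G$ such that every vertex in $V_G-D$ has a neighbor in $D$. Running time is measured in the standard unit-cost RAM model, with the graph given by adjacency lists (or an adjacency matrix). *)

theory Defs
  imports "HOL-Library.Landau_Symbols" "Graph_Theory.Graph_Theory"
begin

section \<open>Graphs\<close>

text \<open>
  A finite simple undirected graph is a \<^locale>\<open>pair_graph\<close>: its arcs form a symmetric,
  irreflexive relation on a finite vertex set, each edge \<open>{u, v}\<close> being the pair of arcs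
  \<open>(u, v)\<close> and \<open>(v, u)\<close>.
\<close>

definition bipartition :: "'a pair_pre_digraph \<Rightarrow> 'a set \<Rightarrow> 'a set \<Rightarrow> bool" where
  "bipartition G A B \<longleftrightarrow>
     A \<union> B = pverts G \<and> A \<inter> B = {} \<and>
     (\<forall>(u, v) \<in> parcs G. u \<in> A \<and> v \<in> B \<or> u \<in> B \<and> v \<in> A)"

definition dominating_set :: "'a pair_pre_digraph \<Rightarrow> 'a set \<Rightarrow> bool" where
  "dominating_set G D \<longleftrightarrow>
     D \<subseteq> pverts G \<and> (\<forall>v \<in> pverts G - D. \<exists>u \<in> D. (v, u) \<in> parcs G)"

definition domination_number :: "'a pair_pre_digraph \<Rightarrow> nat" where
  "domination_number G = (LEAST k. \<exists>D. dominating_set G D \<and> card D = k)"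


section \<open>The unit-cost RAM\<close>

text \<open>
  The random access machine of Cook and Reckhow: registers \<open>X\<^sub>0, X\<^sub>1, \<dots>\<close> holding natural
  numbers, a read-only input tape, and a program that is a fixed finite list of instructions.
  There is no multiplication, so unit cost does not give the machine more than the usual power.
\<close>

datatype instr =
    Const nat nat       \<comment> \<open>\<open>Const i c\<close>: \<open>X\<^sub>i := c\<close>\<close>
  | Add nat nat nat     \<comment> \<open>\<open>Add i j k\<close>: \<open>X\<^sub>i := X\<^sub>j + X\<^sub>k\<close>\<close>
  | Sub nat nat nat     \<comment> \<open>\<open>Sub i j k\<close>: \<open>X\<^sub>i := max 0 (X\<^sub>j - X\<^sub>k)\<close>\<close>
  | Load nat nat        \<comment> \<open>\<open>Load i j\<close>: \<open>X\<^sub>i :=\<close> the register whose index is in \<open>X\<^sub>j\<close>\<close>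
  | Store nat nat       \<comment> \<open>\<open>Store i j\<close>: the register whose index is in \<open>X\<^sub>i\<close> gets \<open>X\<^sub>j\<close>\<close>
  | JumpPos nat nat     \<comment> \<open>\<open>JumpPos i l\<close>: continue at instruction \<open>l\<close> if \<open>X\<^sub>i > 0\<close>\<close>
  | Read nat            \<comment> \<open>\<open>Read i\<close>: \<open>X\<^sub>i :=\<close> next number on the input tape, \<open>0\<close> past its end\<close>

record config =
  pc :: nat
  mem :: "nat \<Rightarrow> nat"
  tape :: "nat list"

fun exec :: "instr \<Rightarrow> config \<Rightarrow> config" where
  "exec (Const i c) s = s\<lparr>pc := pc s + 1, mem := (mem s)(i := c)\<rparr>"
| "exec (Add i j k) s = s\<lparr>pc := pc s + 1, mem := (mem s)(i := mem s j + mem s k)\<rparr>"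
| "exec (Sub i j k) s = s\<lparr>pc := pc s + 1, mem := (mem s)(i := mem s j - mem s k)\<rparr>"
| "exec (Load i j) s = s\<lparr>pc := pc s + 1, mem := (mem s)(i := mem s (mem s j))\<rparr>"
| "exec (Store i j) s = s\<lparr>pc := pc s + 1, mem := (mem s)(mem s i := mem s j)\<rparr>"
| "exec (JumpPos i l) s = s\<lparr>pc := (if mem s i > 0 then l else pc s + 1)\<rparr>"
| "exec (Read i) s =
     s\<lparr>pc := pc s + 1, mem := (mem s)(i := (case tape s of [] \<Rightarrow> 0 | x # _ \<Rightarrow> x)),
       tape := tl (tape s)\<rparr>"

text \<open>The machine halts when the program counter leaves the program; it then stays put.\<close>

definition halted :: "instr list \<Rightarrow> config \<Rightarrow> bool" where
  "halted P s \<longleftrightarrow> length P \<le> pc s"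

definition step :: "instr list \<Rightarrow> config \<Rightarrow> config" where
  "step P s = (if halted P s then s else exec (P ! pc s) s)"

definition initial :: "nat list \<Rightarrow> config" where
  "initial inp = \<lparr>pc = 0, mem = (\<lambda>_. 0), tape = inp\<rparr>"

text \<open>
  On input \<open>inp\<close> the program executes at most \<open>t\<close> instructions and halts with the truth value
  \<open>b\<close>, coded as \<open>1\<close> or \<open>0\<close>, in \<open>X\<^sub>0\<close>.
\<close>

definition answers_within :: "instr list \<Rightarrow> nat list \<Rightarrow> bool \<Rightarrow> nat \<Rightarrow> bool" where
  "answers_within P inp b t \<longleftrightarrow>
     (\<exists>k \<le> t. halted P ((step P ^^ k) (initial inp)) \<and>
              mem ((step P ^^ k) (initial inp)) 0 = (if b then 1 else 0))"


section \<open>Bipartite graphs as RAM input\<close>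

text \<open>
  For a bipartite graph \<open>((A, B), E)\<close> on the vertices \<open>0, \<dots>, n - 1\<close> the tape holds \<open>n\<close>, then one
  bit per vertex telling whether it lies in \<open>A\<close>, then the edges in one of two formats.
\<close>

definition header :: "nat pair_pre_digraph \<Rightarrow> nat set \<Rightarrow> nat list" where
  "header G A =
     (let n = card (pverts G) in n # map (\<lambda>v. if v \<in> A then 1 else 0) [0..<n])"

definition matrix_input :: "nat pair_pre_digraph \<Rightarrow> nat set \<Rightarrow> nat list \<Rightarrow> bool" where
  "matrix_input G A inp \<longleftrightarrow>
     (let n = card (pverts G) in
      inp = header G A @
        concat (map (\<lambda>u. map (\<lambda>v. if (u, v) \<in> parcs G then 1 else 0) [0..<n]) [0..<n]))"

text \<open>
  Each adjacency list is preceded by its length; its elements may come in any order, so a graph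
  has several admissible inputs.
\<close>

definition adjacency_lists_input :: "nat pair_pre_digraph \<Rightarrow> nat set \<Rightarrow> nat list \<Rightarrow> bool" where
  "adjacency_lists_input G A inp \<longleftrightarrow>
     (\<exists>adj. length adj = card (pverts G) \<and>
        (\<forall>v < length adj. distinct (adj ! v) \<and> set (adj ! v) = {w. (v, w) \<in> parcs G}) \<and>
        inp = header G A @ concat (map (\<lambda>ws. length ws # ws) adj))"

end

theory Submission
  imports Defs
begin

text \<open>
  No vertex is isolated, so A dominates. Call a vertex of A a support if it is the only neighbour of
  some vertex, and call two vertices with neighbourhood {x, y} twins of the pair x, y. If non-supports
  x, y in A have a common neighbour but no twins, then both can be exchanged for a single common
  neighbour, so A is not a minimum dominating set. Conversely, if all such pairs have twins, then a
  dominating set has at least as many vertices in B as it misses in A. Hence \<open>\<gamma>(G) = |A|\<close> iff any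
  two non-supports in A with a common neighbour have twins.

  Testing all pairs at every vertex z would be cubic. Instead, a pair that has twins is represented by
  the second of its twins; at z it suffices to compare the number of pairs of non-supports of A
  adjacent to z with the number of representatives whose two neighbours are such vertices. Both
  numbers are found in O(n) steps once the degree and the least and greatest neighbour of every vertex
  are known.
\<close>

section \<open>When the smaller side is a minimum dominating set\<close>

text \<open>Two twins, not one, are needed: if x and y are both missing from a dominating set, each
  must be paid for by a vertex of B of its own, whereas a single vertex with neighbourhood {x, y}
  could replace both. The counting test is exact because a pair with twins has one representative
  and a representative determines its pair. Hence the representatives counted at z are in bijection
  with the pairs at z that have twins, and equality of two finite cardinalities leaves no pair
  without twins. One z may see quadratically many pairs, but their number comes out of a single scan
  and there are at most n representatives, so no pairs are ever listed. On the machine every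
  decision is arithmetic on bits, because straight-line blocks and loops tested after the body are
  the only control structures used. Such a loop runs at least once; when adjacency lists are read,
  this is again secured by the absence of isolated vertices.\<close>

definition nbrs :: "(nat \<times> nat) set \<Rightarrow> nat \<Rightarrow> nat set" where
  "nbrs E u = {v. (u, v) \<in> E}"

definition support :: "(nat \<times> nat) set \<Rightarrow> nat \<Rightarrow> bool" where
  "support E x \<longleftrightarrow> (\<exists>w. nbrs E w = {x})"

definition twin_pair :: "(nat \<times> nat) set \<Rightarrow> nat \<Rightarrow> nat \<Rightarrow> bool" where
  "twin_pair E x y \<longleftrightarrow> (\<exists>w w'. w \<noteq> w' \<and> nbrs E w = {x, y} \<and> nbrs E w' = {x, y})"

definition twinned :: "(nat \<times> nat) set \<Rightarrow> nat set \<Rightarrow> bool" where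
  "twinned E A \<longleftrightarrow>
     (\<forall>z. \<forall>x \<in> nbrs E z \<inter> A. \<forall>y \<in> nbrs E z \<inter> A.
        \<not> support E x \<longrightarrow> \<not> support E y \<longrightarrow> x \<noteq> y \<longrightarrow> twin_pair E x y)"

locale bipartite_nonisolated =
  fixes G :: "nat pair_pre_digraph" and A B :: "nat set" and E
  assumes E_def: "E = parcs G"
    and fin: "finite (pverts G)"
    and symE: "\<And>u v. (u, v) \<in> E \<Longrightarrow> (v, u) \<in> E"
    and bip: "bipartition G A B"
    and nonisolated: "\<And>v. v \<in> pverts G \<Longrightarrow> nbrs E v \<noteq> {}"
begin

lemma V: "pverts G = A \<union> B" and disj: "A \<inter> B = {}"
  and finA: "finite A" and finB: "finite B"
  and nbA: "x \<in> A \<Longrightarrow> nbrs E x \<subseteq> B" and nbB: "x \<in> B \<Longrightarrow> nbrs E x \<subseteq> A"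
  and nbrs_other: "x \<notin> A \<union> B \<Longrightarrow> nbrs E x = {}"
proof -
  show V: "pverts G = A \<union> B" and "A \<inter> B = {}"
    using bip by (auto simp: bipartition_def)
  show "finite A" "finite B"
    using fin V by auto
qed (use bip in \<open>auto simp: bipartition_def nbrs_def E_def\<close>)

lemma nbrs_sym: "x \<in> nbrs E y \<longleftrightarrow> y \<in> nbrs E x"
  using symE by (auto simp: nbrs_def)

lemma in_B_if_nbr_in_A: "x \<in> nbrs E w \<Longrightarrow> x \<in> A \<Longrightarrow> w \<in> B"
  using nbA nbrs_other nbrs_sym by fastforce

lemma dominating_iff:
  "dominating_set G D \<longleftrightarrow> D \<subseteq> A \<union> B \<and> (\<forall>v \<in> A \<union> B - D. \<exists>u \<in> D. u \<in> nbrs E v)"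
  by (simp add: dominating_set_def V nbrs_def E_def)

lemma dominating_A: "dominating_set G A"
  unfolding dominating_iff using nonisolated nbB V by blast

lemma domination_number_le: "dominating_set G D \<Longrightarrow> domination_number G \<le> card D"
  unfolding domination_number_def by (rule Least_le) auto

lemma smaller_dominating_set:
  assumes z: "x \<in> nbrs E z \<inter> A" "y \<in> nbrs E z \<inter> A" and ns: "\<not> support E x" "\<not> support E y"
    and "x \<noteq> y" "\<not> twin_pair E x y"
  shows "domination_number G < card A"
proof -
  \<comment> \<open>Without twins at most one vertex has neighbourhood {x, y}. If there is one, it
    must be the vertex taken in, since it would lose all its dominators; otherwise any common
    neighbour will do.\<close>
  have "\<exists>z0. x \<in> nbrs E z0 \<and> y \<in> nbrs E z0 \<and> (\<forall>w. nbrs E w = {x, y} \<longrightarrow> w = z0)"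
  proof (cases "\<exists>w. nbrs E w = {x, y}")
    case True
    then show ?thesis using assms(6) unfolding twin_pair_def by blast
  next
    case False
    then show ?thesis using z by blast
  qed
  then obtain z0 where z0: "x \<in> nbrs E z0" "y \<in> nbrs E z0" "\<And>w. nbrs E w = {x, y} \<Longrightarrow> w = z0"
    by blast
  have "z0 \<in> B" using z0 z in_B_if_nbr_in_A by blast
  let ?D = "insert z0 (A - {x, y})"
  have "\<exists>u\<in>?D. u \<in> nbrs E v" if v: "v \<in> A \<union> B - ?D" for v
  proof (cases "v \<in> A")
    case True
    then show ?thesis using v z0 nbrs_sym by blast
  next
    case False
    then have "v \<in> B" "v \<noteq> z0" using v by auto
    then have "nbrs E v \<subseteq> A" "nbrs E v \<noteq> {}" using nbB nonisolated V by auto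
    \<comment> \<open>These are the only nonempty subsets of {x, y}, so \<open>v\<close> keeps a
      neighbour in A outside {x, y}.\<close>
    moreover have "nbrs E v \<noteq> {x}" "nbrs E v \<noteq> {y}" "nbrs E v \<noteq> {x, y}"
      using ns z0(3) \<open>v \<noteq> z0\<close> unfolding support_def by blast+
    ultimately show ?thesis by blast
  qed
  then have "dominating_set G ?D" using \<open>z0 \<in> B\<close> by (auto simp: dominating_iff)
  then have "domination_number G \<le> card ?D" by (rule domination_number_le)
  also have "card ?D = Suc (card (A - {x, y}))" using \<open>z0 \<in> B\<close> disj finA by (subst card_insert_disjoint) auto
  also have "\<dots> < card A"
  proof -
    have "card {x, y} = 2" using \<open>x \<noteq> y\<close> by simp
    moreover have "card {x, y} \<le> card A" using z finA by (intro card_mono) auto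
    moreover have "card (A - {x, y}) = card A - card {x, y}" using z by (intro card_Diff_subset) auto
    ultimately show ?thesis by simp
  qed
  finally show ?thesis .
qed

text \<open>
  Every vertex of A missing from a dominating set D is charged to a vertex of D in B: a support to a
  vertex of which it is the only neighbour, a non-support sharing a neighbour with another missing
  non-support to one of two twins of that pair (the order of the pair says which one), any other
  vertex to any neighbour in D.
\<close>
lemma card_dominating_set:
  assumes tw: "twinned E A" and D: "dominating_set G D"
  shows "card A \<le> card D"
proof -
  have finD: "finite D" using D finA finB by (auto simp: dominating_iff intro: finite_subset)
  define X where "X = {x \<in> A - D. \<not> support E x}"
  have "\<forall>x y. \<exists>w1 w2. twin_pair E x y \<longrightarrow> w1 \<noteq> w2 \<and> nbrs E w1 = {x, y} \<and> nbrs E w2 = {x, y}"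
    unfolding twin_pair_def by blast
  then obtain t1 t2 where t: "\<And>x y. twin_pair E x y \<Longrightarrow>
      t1 x y \<noteq> t2 x y \<and> nbrs E (t1 x y) = {x, y} \<and> nbrs E (t2 x y) = {x, y}"
    by metis
  \<comment> \<open>The values of \<open>t1\<close> and \<open>t2\<close> at (x, y) are unrelated to
    those at (y, x). Evaluating both orders at the increasing pair makes \<open>g x y\<close> and
    \<open>g y x\<close> the two twins of one choice.\<close>
  define g where "g = (\<lambda>x y. if x < y then t1 x y else t2 y x)"
  have twin_sym: "twin_pair E x y \<longleftrightarrow> twin_pair E y x" for x y
    unfolding twin_pair_def by (simp add: insert_commute)
  have g: "nbrs E (g x y) = {x, y}" if "twin_pair E x y" for x y
    using t[OF that] t[OF that[unfolded twin_sym[of x]]] by (auto simp: g_def)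
  have g_neq: "g x y \<noteq> g y x" if "twin_pair E x y" "x \<noteq> y" for x y
    using t[OF that(1)] t[OF that(1)[unfolded twin_sym[of x]]] that(2)
    by (cases x y rule: linorder_cases) (auto simp: g_def)
  \<comment> \<open>A vertex without neighbours in \<open>D\<close> can satisfy domination only by
    lying in \<open>D\<close> itself.\<close>
  have in_D: "w \<in> D" if "x \<in> nbrs E w" "nbrs E w \<subseteq> A - D" for w x
    using D that in_B_if_nbr_in_A[of x w] unfolding dominating_iff by blast
  have "\<forall>x \<in> A - D. \<exists>w. w \<in> D \<inter> B \<and> ((support E x \<and> nbrs E w = {x}) \<or>
      (x \<in> X \<and> nbrs E w \<inter> X = {x}) \<or>
      (x \<in> X \<and> (\<exists>y \<in> X. y \<noteq> x \<and> twin_pair E x y \<and> w = g x y)))" (is "\<forall>x \<in> _. \<exists>w. ?charged x w")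
  proof
    fix x assume x: "x \<in> A - D"
    consider "support E x" | y z where "x \<in> X" "y \<in> X" "y \<noteq> x" "x \<in> nbrs E z" "y \<in> nbrs E z"
      | "x \<in> X" "\<And>z. x \<in> nbrs E z \<Longrightarrow> nbrs E z \<inter> X = {x}"
      by (cases "support E x") (use x in \<open>auto simp: X_def\<close>)
    then show "\<exists>w. ?charged x w"
    proof cases
      case 1
      then obtain w where "nbrs E w = {x}" by (auto simp: support_def)
      then show ?thesis using x in_D[of x w] in_B_if_nbr_in_A[of x w] 1 by auto
    next
      case 2
      then have "twin_pair E x y" using tw unfolding twinned_def X_def by blast
      moreover from this have "g x y \<in> D" "g x y \<in> B"
        using g[of x y] 2 in_D[of x "g x y"] in_B_if_nbr_in_A[of x "g x y"] x by (auto simp: X_def)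
      ultimately show ?thesis using 2 by blast
    next
      case 3
      obtain w where "w \<in> D" "x \<in> nbrs E w" using D x nbrs_sym unfolding dominating_iff by blast
      moreover from this have "w \<in> B" using x in_B_if_nbr_in_A by blast
      ultimately show ?thesis using 3 by blast
    qed
  qed
  from bchoice[OF this] obtain f where f: "\<forall>x \<in> A - D. ?charged x (f x)" ..
  have "inj_on f (A - D)"
  proof (rule inj_onI)
    fix x x' assume x: "x \<in> A - D" "x' \<in> A - D" and eq: "f x = f x'"
    \<comment> \<open>The three modes differ in how many elements of \<open>X\<close> the charged
      vertex sees: none, one or two. In the first two its neighbourhood gives \<open>v\<close> back,
      in the third only up to exchange with \<open>u\<close>.\<close>
    have charged: "nbrs E (f v) = {v} \<and> v \<notin> X \<or> nbrs E (f v) \<inter> X = {v} \<and> v \<in> X \<or>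
        (\<exists>u \<in> X. v \<in> X \<and> u \<noteq> v \<and> twin_pair E v u \<and> f v = g v u \<and> nbrs E (f v) = {v, u})"
      if "v \<in> A - D" for v
    proof -
      have "v \<notin> X" if "support E v" using that by (simp add: X_def)
      from bspec[OF f \<open>v \<in> A - D\<close>, THEN conjunct2] show ?thesis
      proof (elim disjE conjE bexE)
        assume "support E v" "nbrs E (f v) = {v}"
        with \<open>support E v \<Longrightarrow> v \<notin> X\<close> show ?thesis by simp
      next
        assume "v \<in> X" "nbrs E (f v) \<inter> X = {v}"
        then show ?thesis by simp
      next
        fix u assume u: "v \<in> X" "u \<in> X" "u \<noteq> v" "twin_pair E v u" "f v = g v u"
        with g[of v u] have "nbrs E (f v) = {v, u}" by simp
        with u show ?thesis by (intro disjI2 bexI[of _ u] conjI)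
      qed
    qed
    show "x = x'"
      using charged[OF x(1)]
    proof (elim disjE)
      assume "\<exists>u \<in> X. x \<in> X \<and> u \<noteq> x \<and> twin_pair E x u \<and> f x = g x u \<and> nbrs E (f x) = {x, u}"
      then obtain u where u: "u \<in> X" "x \<in> X" "u \<noteq> x" "twin_pair E x u" "f x = g x u"
        "nbrs E (f x) = {x, u}" by blast
      \<comment> \<open>This settles the remaining ambiguity: if \<open>x'\<close> were the partner
        \<open>u\<close> charged for the same pair, it would have received the other twin.\<close>
      then have "g x u \<noteq> g u x" using g_neq by blast
      from charged[OF x(2), folded eq] show "x = x'"
      proof (elim disjE bexE conjE)
        fix u' assume "f x = g x' u'" "nbrs E (f x) = {x', u'}"
        with u \<open>g x u \<noteq> g u x\<close> show "x = x'" by (metis doubleton_eq_iff)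
      qed (use u(1-3,6) in auto)
    next
      assume "nbrs E (f x) = {x} \<and> x \<notin> X"
      with charged[OF x(2), folded eq] show "x = x'" by (elim disjE bexE) auto
    next
      assume "nbrs E (f x) \<inter> X = {x} \<and> x \<in> X"
      with charged[OF x(2), folded eq] show "x = x'" by (elim disjE bexE) auto
    qed
  qed
  moreover have "f ` (A - D) \<subseteq> D \<inter> B"
  proof (rule image_subsetI)
    show "f x \<in> D \<inter> B" if "x \<in> A - D" for x using bspec[OF f that] by (rule conjunct1)
  qed
  ultimately have "card (A - D) \<le> card (D \<inter> B)" using finD by (intro card_inj_on_le) auto
  moreover have "card A = card (A \<inter> D) + card (A - D)" using finA by (simp add: card_Int_Diff)
  moreover have "card D \<ge> card (A \<inter> D) + card (D \<inter> B)"
    using finD disj by (subst card_Un_disjoint[symmetric]) (auto intro: card_mono)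
  ultimately show ?thesis by simp
qed

theorem domination_number_eq_iff: "domination_number G = card A \<longleftrightarrow> twinned E A"
proof
  assume "domination_number G = card A"
  then have twin: "twin_pair E x y" if "x \<in> nbrs E z \<inter> A" "y \<in> nbrs E z \<inter> A" "\<not> support E x" "\<not> support E y"
    "x \<noteq> y" for x y z
    using smaller_dominating_set[OF that] by (cases "twin_pair E x y") simp_all
  show "twinned E A" unfolding twinned_def
  proof (intro allI ballI impI)
    fix z x y assume "x \<in> nbrs E z \<inter> A" "y \<in> nbrs E z \<inter> A" "\<not> support E x" "\<not> support E y" "x \<noteq> y"
    then show "twin_pair E x y" by (rule twin)
  qed
next
  assume tw: "twinned E A"
  have "\<exists>D. dominating_set G D \<and> card D = domination_number G"
    unfolding domination_number_def by (rule LeastI_ex) (use dominating_A in blast)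
  then obtain D where "dominating_set G D" "card D = domination_number G" by blast
  with card_dominating_set[OF tw] have "card A \<le> domination_number G" by fastforce
  with domination_number_le[OF dominating_A] show "domination_number G = card A" by simp
qed

end

text \<open>Connectedness is strong connectedness of the symmetrised graph. The arcs are symmetric
  already, so a directed path leads from \<open>u\<close> to \<open>v\<close>, and its first arc
  supplies the neighbour.\<close>

lemma connected_nonisolated:
  assumes "pair_graph G" "Digraph_Component.connected (with_proj G)"
    and "u \<in> pverts G" "v \<in> pverts G" "u \<noteq> v"
  shows "\<exists>w. (u, w) \<in> parcs G"
proof -
  interpret pair_graph G by fact
  have sym: "symmetric (with_proj G)" ..
  have "u \<rightarrow>\<^sup>*\<^bsub>with_proj (mk_symmetric (with_proj G))\<^esub> v"
    using assms(2-4) by (simp add: Digraph_Component.connected_def strongly_connected_def)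
  then have "u \<rightarrow>\<^sup>*\<^bsub>with_proj G\<^esub> v"
    using reachable_mk_symmetric_eq[OF sym] by blast
  then show ?thesis
    using \<open>u \<noteq> v\<close> by (cases rule: converse_reachable_cases) auto
qed


section \<open>Structured programs for the RAM\<close>

text \<open>Jump targets are absolute, so a piece of code depends on the address at which it is placed.\<close>

type_synonym code = "nat \<Rightarrow> instr list"
type_synonym assertion = "(nat \<Rightarrow> nat) \<Rightarrow> nat list \<Rightarrow> bool"

definition block :: "instr list \<Rightarrow> code" where
  "block is = (\<lambda>_. is)"

definition seq :: "code \<Rightarrow> code \<Rightarrow> code" (infixr ";;" 60) where
  "c ;; c' = (\<lambda>l. c l @ c' (l + length (c l)))"

definition do_while :: "code \<Rightarrow> nat \<Rightarrow> code" where
  "do_while c i = (\<lambda>l. c l @ [JumpPos i l])"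

text \<open>Quantifying over the surrounding instructions makes the triple independent of where the
  code is placed. Termination, the time bound and exit exactly behind the code are claimed together,
  which is what composition needs.\<close>

definition wp :: "code \<Rightarrow> nat \<Rightarrow> assertion \<Rightarrow> assertion" where
  "wp c t R m tp \<longleftrightarrow>
     (\<forall>pre post s. pc s = length pre \<longrightarrow> mem s = m \<longrightarrow> tape s = tp \<longrightarrow>
        (\<exists>k \<le> t. \<exists>s'. (step (pre @ c (length pre) @ post) ^^ k) s = s' \<and>
           pc s' = length pre + length (c (length pre)) \<and> R (mem s') (tape s')))"

text \<open>Symbolic execution of straight-line code, whose running time is its length. Jumps are
  rejected, so that they arise from \<open>do_while\<close> only.\<close>

fun wp_instrs :: "instr list \<Rightarrow> assertion \<Rightarrow> assertion" where
  "wp_instrs [] R m tp = R m tp"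
| "wp_instrs (Const i c # is) R m tp = wp_instrs is R (m(i := c)) tp"
| "wp_instrs (Add i j k # is) R m tp = wp_instrs is R (m(i := m j + m k)) tp"
| "wp_instrs (Sub i j k # is) R m tp = wp_instrs is R (m(i := m j - m k)) tp"
| "wp_instrs (Load i j # is) R m tp = wp_instrs is R (m(i := m (m j))) tp"
| "wp_instrs (Store i j # is) R m tp = wp_instrs is R (m(m i := m j)) tp"
| "wp_instrs (JumpPos i l # is) R m tp = False"
| "wp_instrs (Read i # is) R m tp =
     wp_instrs is R (m(i := (case tp of [] \<Rightarrow> 0 | x # _ \<Rightarrow> x))) (tl tp)"

lemma wpE:
  assumes "wp c t R (mem s) (tape s)" "pc s = length pre"
  obtains k s' where "k \<le> t" "(step (pre @ c (length pre) @ post) ^^ k) s = s'"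
    "pc s' = length pre + length (c (length pre))" "R (mem s') (tape s')"
  using assms unfolding wp_def by metis

lemma wp_instrs_sound:
  assumes "wp_instrs is R (mem s) (tape s)" "pc s = length pre"
  shows "\<exists>s'. (step (pre @ is @ post) ^^ length is) s = s' \<and>
           pc s' = length pre + length is \<and> R (mem s') (tape s')"
  using assms
proof (induction "is" arbitrary: s pre)
  case Nil
  then show ?case by simp
next
  case (Cons a "is")
  define s1 where "s1 = step (pre @ (a # is) @ post) s"
  have s1: "s1 = exec a s"
    using Cons.prems by (simp add: s1_def step_def halted_def)
  have "wp_instrs is R (mem s1) (tape s1) \<and> pc s1 = length (pre @ [a])"
    using Cons.prems unfolding s1 by (cases a) auto
  \<comment> \<open>The executed instruction joins the prefix, so the program as a whole is
    unchanged.\<close>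
  with Cons.IH[of s1 "pre @ [a]"] show ?case
    by (simp add: s1_def funpow_Suc_right del: funpow.simps)
qed

lemma wp_block:
  assumes "wp_instrs is R m tp" "length is \<le> t"
  shows "wp (block is) t R m tp"
  unfolding wp_def block_def using wp_instrs_sound assms by blast

lemma wp_seq:
  assumes "wp c t R' m tp" "\<And>m tp. R' m tp \<Longrightarrow> wp c' t' R m tp" "t + t' \<le> u"
  shows "wp (c ;; c') u R m tp"
  unfolding wp_def
proof (intro allI impI)
  fix pre post :: "instr list" and s :: config
  assume s: "pc s = length pre" "mem s = m" "tape s = tp"
  let ?l = "length pre"
  let ?P = "pre @ (c ;; c') ?l @ post"
  let ?pre = "pre @ c ?l"
  have P1: "?P = pre @ c ?l @ (c' (length ?pre) @ post)" by (simp add: seq_def)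
  have P2: "?P = ?pre @ c' (length ?pre) @ post" by (simp add: seq_def)
  obtain k s1 where k: "k \<le> t" "(step ?P ^^ k) s = s1" "pc s1 = length ?pre" "R' (mem s1) (tape s1)"
    using wpE[of c t R' s pre "c' (length ?pre) @ post"] assms(1) s
    unfolding P1 by auto
  obtain k' s2 where k': "k' \<le> t'" "(step ?P ^^ k') s1 = s2"
    "pc s2 = length ?pre + length (c' (length ?pre))" "R (mem s2) (tape s2)"
    using wpE[of c' t' R s1 ?pre post] assms(2) k unfolding P2 by auto
  have "(step ?P ^^ (k' + k)) s = s2" using k k' by (simp add: funpow_add)
  moreover have "pc s2 = ?l + length ((c ;; c') ?l)" using k' by (simp add: seq_def)
  ultimately show "\<exists>k\<le>u. \<exists>s'. (step ?P ^^ k) s = s' \<and> pc s' = ?l + length ((c ;; c') ?l) \<and> R (mem s') (tape s')"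
    using k k' assms(3) by (intro exI[of _ "k' + k"]) auto
qed

text \<open>Since the test follows the body, the loop must be entered with work to do, and the
  invariant fixes the number \<open>N\<close> of rounds in advance. \<open>Suc t\<close> pays for
  the body and the jump.\<close>

lemma wp_do_while:
  assumes init: "I 0 m tp" and "0 < N"
    and body: "\<And>j m tp. j < N \<Longrightarrow> I j m tp \<Longrightarrow>
      wp c t (\<lambda>m tp. I (Suc j) m tp \<and> (0 < m i \<longleftrightarrow> Suc j < N)) m tp"
    and post: "\<And>m tp. I N m tp \<Longrightarrow> R m tp"
    and t: "N * Suc t \<le> u"
  shows "wp (do_while c i) u R m tp"
  unfolding wp_def
proof (intro allI impI)
  fix pre post :: "instr list" and s :: config
  assume s: "pc s = length pre" "mem s = m" "tape s = tp"
  let ?l = "length pre"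
  let ?P = "pre @ do_while c i ?l @ post"
  have P: "?P = pre @ c ?l @ (JumpPos i ?l # post)" by (simp add: do_while_def)
  have once: "\<exists>k\<le>Suc t. \<exists>s'. (step ?P ^^ k) s = s' \<and> I (Suc j) (mem s') (tape s') \<and>
      pc s' = (if Suc j < N then ?l else ?l + length (do_while c i ?l))"
    if j: "j < N" "I j (mem s) (tape s)" and pc: "pc s = ?l" for j s
  proof -
    obtain k s1 where k: "k \<le> t" "(step ?P ^^ k) s = s1" "pc s1 = ?l + length (c ?l)"
      and I: "I (Suc j) (mem s1) (tape s1)" "0 < mem s1 i \<longleftrightarrow> Suc j < N"
      using wpE[OF body[OF j] pc, of "JumpPos i ?l # post"] unfolding P by metis
    have "?P ! pc s1 = JumpPos i ?l" "\<not> halted ?P s1"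
      using k by (simp_all add: P nth_append halted_def)
    then have "step ?P s1 = s1\<lparr>pc := if Suc j < N then ?l else pc s1 + 1\<rparr>"
      using I by (simp add: step_def)
    then show ?thesis
      using k I by (intro exI[of _ "Suc k"]) (auto simp: do_while_def)
  qed
  have iter: "\<exists>k\<le>Suc j * Suc t. \<exists>s'. (step ?P ^^ k) s = s' \<and> I (Suc j) (mem s') (tape s') \<and>
      pc s' = (if Suc j < N then ?l else ?l + length (do_while c i ?l))" if "j < N" for j
    using that
  proof (induction j)
    case 0
    then show ?case using once[of 0 s] init s by auto
  next
    case (Suc j)
    then obtain k s1 where k: "k \<le> Suc j * Suc t" "(step ?P ^^ k) s = s1"
      "I (Suc j) (mem s1) (tape s1)" "pc s1 = ?l"
      by auto
    obtain k' s2 where k': "k' \<le> Suc t" "(step ?P ^^ k') s1 = s2"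
      "I (Suc (Suc j)) (mem s2) (tape s2)"
      "pc s2 = (if Suc (Suc j) < N then ?l else ?l + length (do_while c i ?l))"
      using once[of "Suc j" s1] Suc.prems k by blast
    have "(step ?P ^^ (k' + k)) s = s2" using k k' by (simp add: funpow_add)
    moreover have "k' + k \<le> Suc (Suc j) * Suc t" using k k' by simp
    ultimately show ?case using k' by blast
  qed
  from iter[of "N - 1"] \<open>0 < N\<close> post t
  show "\<exists>k\<le>u. \<exists>s'. (step ?P ^^ k) s = s' \<and> pc s' = ?l + length (do_while c i ?l) \<and> R (mem s') (tape s')"
    by (auto intro: order_trans)
qed

lemma wp_block_seq:
  assumes "wp_instrs is (wp c t R) m tp" "length is + t \<le> u"
  shows "wp (block is ;; c) u R m tp"
  using assms by (intro wp_seq[OF wp_block]) auto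

lemma wp_seq':
  assumes "wp c t (wp c' t' R) m tp" "t + t' \<le> u"
  shows "wp (c ;; c') u R m tp"
  using assms by (intro wp_seq) auto


section \<open>The algorithm on the adjacency matrix\<close>

text \<open>
  Registers below 30 are scalars: 2 holds the constant 1, 20 holds 0, 22 the address 20 and 24 holds n.
  Registers 3 to 8 hold the base addresses of five arrays of length n and of the adjacency matrix,
  which is stored by rows. The arrays hold, for each vertex, a flag for being a candidate
  non-support in A, the degree, the greatest and the least neighbour, and a flag for being a
  representative.
\<close>

definition regs :: "nat \<Rightarrow> (nat \<Rightarrow> nat) \<Rightarrow> bool" where
  "regs n m \<longleftrightarrow> 0 < n \<and> m 2 = 1 \<and> m 20 = 0 \<and> m 22 = 20 \<and> m 24 = n \<and> m 3 = 30 \<and> m 4 = 30 + n \<and>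
     m 5 = 30 + 2 * n \<and> m 6 = 30 + 3 * n \<and> m 7 = 30 + 4 * n \<and> m 8 = 30 + 5 * n"

definition frame :: "nat set \<Rightarrow> (nat \<Rightarrow> nat) \<Rightarrow> (nat \<Rightarrow> nat) \<Rightarrow> bool" where
  "frame X m m' \<longleftrightarrow> (\<forall>x. x \<notin> X \<longrightarrow> m' x = m x)"

lemma frame_trans: "frame X m m' \<Longrightarrow> frame Y m' m'' \<Longrightarrow> Y \<subseteq> X \<Longrightarrow> frame X m m''"
  by (auto simp: frame_def subset_iff)

definition arr :: "(nat \<Rightarrow> nat) \<Rightarrow> nat \<Rightarrow> nat \<Rightarrow> (nat \<Rightarrow> nat) \<Rightarrow> bool" where
  "arr m b n f \<longleftrightarrow> (\<forall>i < n. m (b + i) = f i)"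

lemma arr_frame:
  assumes "arr m b n f" "frame X m m'" and X: "\<And>x. x \<in> X \<Longrightarrow> x < b \<or> b + n \<le> x"
  shows "arr m' b n f"
proof -
  have "m' (b + i) = f i" if "i < n" for i
  proof -
    have "b + i \<notin> X" using X[of "b + i"] that by fastforce
    then show ?thesis using assms(1,2) that unfolding arr_def frame_def by metis
  qed
  then show ?thesis by (simp add: arr_def)
qed

lemma frame_upd: "frame X m m' \<Longrightarrow> x \<in> X \<Longrightarrow> frame X m (m'(x := y))"
  by (auto simp: frame_def)

lemma arr_upd:
  assumes "x < b \<or> b + n \<le> x"
  shows "arr (m(x := y)) b n f \<longleftrightarrow> arr m b n f"
proof -
  have "b + i \<noteq> x" if "i < n" for i using assms that by linarith
  then show ?thesis by (simp add: arr_def)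
qed

lemma arr_Suc: "arr m b (Suc n) f \<longleftrightarrow> arr m b n f \<and> m (b + n) = f n"
  by (auto simp: arr_def less_Suc_eq)

lemma regs_frame:
  "regs n m \<Longrightarrow> frame X m m' \<Longrightarrow> {2, 3, 4, 5, 6, 7, 8, 20, 22, 24} \<inter> X = {} \<Longrightarrow> regs n m'"
  unfolding frame_def regs_def by simp

primrec acc_max :: "(nat \<Rightarrow> nat) \<Rightarrow> nat \<Rightarrow> nat" where
  "acc_max f 0 = 0"
| "acc_max f (Suc j) = acc_max f j + (f j - acc_max f j)"

section \<open>Copying and scanning one row\<close>

definition read_row :: code where
  "read_row = block [Add 12 24 20] ;;
     do_while (block [Read 16, Store 9 16, Add 9 9 2, Sub 12 12 2]) 12"

text \<open>Each entry costs four instructions and a jump, and one more instruction sets the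
  counter; the bounds of the later loops arise in the same way.\<close>

lemma wp_read_row:
  assumes regs: "regs n m" and b: "m 9 = b" "30 \<le> b" and xs: "length xs = n"
    and t: "5 * n + 1 \<le> t"
    and post: "\<And>m'. arr m' b n (nth xs) \<Longrightarrow> m' 9 = b + n \<Longrightarrow>
      frame ({9, 12, 16} \<union> {b..<b + n}) m m' \<Longrightarrow> R m' rest"
  shows "wp read_row t R m (xs @ rest)"
proof -
  define I where "I = (\<lambda>j m' tp. arr m' b j (nth xs) \<and> m' 9 = b + j \<and> m' 12 = n - j \<and>
    tp = drop j xs @ rest \<and> frame ({9, 12, 16} \<union> {b..<b + j}) m m')"
  show ?thesis
    unfolding read_row_def
  proof (rule wp_block_seq[where t = "5 * n"], simp, rule wp_do_while[where I = I and N = n and t = 4])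
    show "I 0 (m(12 := m 24 + m 20)) (xs @ rest)"
      using regs b by (simp add: I_def arr_def frame_def regs_def)
    show "0 < n" using regs by (simp add: regs_def)
    fix j m' tp assume j: "j < n" "I j m' tp"
    then have tp: "tp = xs ! j # (drop (Suc j) xs @ rest)"
      using xs by (simp add: I_def Cons_nth_drop_Suc)
    have "m' 2 = 1" using j b regs by (simp add: I_def frame_def regs_def)
    then show "wp (block [Read 16, Store 9 16, Add 9 9 2, Sub 12 12 2]) 4
      (\<lambda>m tp. I (Suc j) m tp \<and> (0 < m 12) = (Suc j < n)) m' tp"
      using j b unfolding tp
      by (intro wp_block) (auto simp: I_def arr_def frame_def less_Suc_eq)
  next
    fix m' tp assume "I n m' tp"
    then show "R m' tp" using post xs by (simp add: I_def)
  qed (use t in auto)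
qed

text \<open>
  There is no multiplication and no forward jump: the product of a bit b and a number is obtained by
  putting the number into register 21 and loading register 20 + b. Maxima are updated by
  \<open>max a b = a + (b - a)\<close> with truncated subtraction, and the minimum of the neighbours v is n minus the
  maximum of the n - v, where register 12 holds n - v.
\<close>

definition scan_body :: "instr list" where
  "scan_body = [Load 16 9, Add 17 16 22,
     Add 21 11 20, Load 18 17, Sub 18 18 14, Add 14 14 18,
     Add 21 12 20, Load 18 17, Sub 18 18 15, Add 15 15 18,
     Add 13 13 16, Add 9 9 2, Add 11 11 2, Sub 12 12 2]"

definition scan_row :: code where
  "scan_row = block [Const 13 0, Const 14 0, Const 15 0, Const 11 0, Add 12 24 20] ;;
     do_while (block scan_body) 12"

lemma wp_scan_row:
  assumes regs: "regs n m" and b: "m 9 = b" "30 \<le> b" and f: "arr m b n f" "\<And>v. f v \<le> 1"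
    and t: "15 * n + 5 \<le> t"
    and post: "\<And>m'. frame {9, 11, 12, 13, 14, 15, 16, 17, 18, 21} m m' \<Longrightarrow> m' 9 = b + n \<Longrightarrow>
      m' 13 = (\<Sum>v<n. f v) \<Longrightarrow> m' 14 = acc_max (\<lambda>v. f v * v) n \<Longrightarrow>
      m' 15 = acc_max (\<lambda>v. f v * (n - v)) n \<Longrightarrow> R m' tp"
  shows "wp scan_row t R m tp"
proof -
  define I where "I = (\<lambda>j m' tp'. frame {9, 11, 12, 13, 14, 15, 16, 17, 18, 21} m m' \<and>
    m' 9 = b + j \<and> m' 11 = j \<and> m' 12 = n - j \<and> m' 13 = (\<Sum>v<j. f v) \<and>
    m' 14 = acc_max (\<lambda>v. f v * v) j \<and> m' 15 = acc_max (\<lambda>v. f v * (n - v)) j \<and> tp' = tp)"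
  show ?thesis
    unfolding scan_row_def
  proof (rule wp_block_seq[where t = "15 * n"], simp, rule wp_do_while[where I = I and N = n and t = 14])
    show "I 0 (m(13 := 0, 14 := 0, 15 := 0, 11 := 0, 12 := m 24 + m 20)) tp"
      using regs b by (simp add: I_def arr_def frame_def regs_def)
    show "0 < n" using regs by (simp add: regs_def)
    fix j m' tp' assume j: "j < n" "I j m' tp'"
    then have r: "m' 2 = 1" "m' 20 = 0" "m' 22 = 20" "m' (b + j) = f j"
      using b regs f(1) by (auto simp: I_def frame_def regs_def arr_def)
    \<comment> \<open>Once the bit is known, register 17 holds the concrete address 20 or 21, and
      symbolic execution can resolve the indirect loads.\<close>
    have "f j = 0 \<or> f j = 1" using f(2)[of j] by linarith
    then show "wp (block scan_body) 14 (\<lambda>m tp. I (Suc j) m tp \<and> (0 < m 12) = (Suc j < n)) m' tp'"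
      using j r by (elim disjE; intro wp_block) (simp_all add: I_def frame_def scan_body_def)
  next
    fix m' tp assume "I n m' tp"
    then show "R m' tp" using post by (simp add: I_def)
  qed (use t in auto)
qed

section \<open>Counting vertices with equal data\<close>

definition absdiff :: "nat \<Rightarrow> nat \<Rightarrow> nat" where
  "absdiff a b = (a - b) + (b - a)"

lemma absdiff_eq_0_iff [simp]: "absdiff a b = 0 \<longleftrightarrow> a = b"
  by (auto simp: absdiff_def)

lemma one_minus_nat: "Suc 0 - x = of_bool (x = 0)"
  by simp

definition add_dist :: "nat \<Rightarrow> nat \<Rightarrow> instr list" where
  "add_dist i j = [Sub 18 i j, Sub 19 j i, Add 23 23 18, Add 23 23 19]"

lemma wp_instrs_append: "wp_instrs (is @ is') R m tp = wp_instrs is (wp_instrs is' R) m tp"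
proof (induction "is" arbitrary: m tp)
  case (Cons i "is")
  then show ?case by (cases i) (simp_all del: fun_upd_apply)
qed simp

lemma length_add_dist [simp]: "length (add_dist i j) = 4"
  by (simp add: add_dist_def)

lemma wp_add_dist:
  assumes "i \<notin> {18, 19, 23}" "j \<notin> {18, 19, 23}"
  shows "wp_instrs (add_dist i j) R m tp \<longleftrightarrow>
    R (m(18 := m i - m j, 19 := m j - m i, 23 := m 23 + absdiff (m i) (m j))) tp"
  using assms by (simp add: add_dist_def absdiff_def add.assoc fun_upd_twist)

text \<open>Three equations are tested at once without branching: the distances add up in register
  23, and 1 minus their sum, truncated, is the conjunction.\<close>

definition count_body :: "instr list" where
  "count_body = [Const 23 0, Add 16 4 11, Load 21 16] @ add_dist 21 13 @
     [Add 16 5 11, Load 21 16] @ add_dist 21 14 @ [Add 16 6 11, Load 21 16] @ add_dist 21 15 @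
     [Sub 23 2 23, Add 17 17 23, Add 11 11 2, Sub 12 12 2]"

definition count_same :: code where
  "count_same = block [Const 17 0, Const 11 0, Add 12 10 2] ;; do_while (block count_body) 12"

text \<open>Only entries up to \<open>u\<close> are required, as the count is taken while the arrays
  are being filled. This is why the second twin represents the pair: it is the first vertex at which
  the existence of twins is known.\<close>

lemma wp_count_same:
  assumes regs: "regs n m" and u: "m 10 = u" "u < n"
    and D: "arr m (30 + n) (Suc u) D" "arr m (30 + 2 * n) (Suc u) H" "arr m (30 + 3 * n) (Suc u) L"
    and u': "m 13 = D u" "m 14 = H u" "m 15 = L u"
    and t: "24 * n + 3 \<le> t"
    and post: "\<And>m'. frame {11, 12, 16, 17, 18, 19, 21, 23} m m' \<Longrightarrow>
      m' 17 = (\<Sum>w<Suc u. of_bool (D w = D u \<and> H w = H u \<and> L w = L u)) \<Longrightarrow> R m' tp"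
  shows "wp count_same t R m tp"
proof -
  define I where "I = (\<lambda>j m' tp'. frame {11, 12, 16, 17, 18, 19, 21, 23} m m' \<and>
    m' 11 = j \<and> m' 12 = Suc u - j \<and>
    m' 17 = (\<Sum>w<j. of_bool (D w = D u \<and> H w = H u \<and> L w = L u)) \<and> tp' = tp)"
  show ?thesis
    unfolding count_same_def
  proof (rule wp_block_seq[where t = "24 * n"], simp, rule wp_do_while[where I = I and N = "Suc u" and t = 23])
    show "I 0 (m(17 := 0, 11 := 0, 12 := m 10 + m 2)) tp"
      using regs u by (simp add: I_def frame_def regs_def)
    fix j m' tp' assume j: "j < Suc u" "I j m' tp'"
    then have r: "m' 2 = 1" "m' 4 = 30 + n" "m' 5 = 30 + 2 * n" "m' 6 = 30 + 3 * n"
      "m' (30 + n + j) = D j" "m' (30 + 2 * n + j) = H j" "m' (30 + 3 * n + j) = L j"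
      "m' 13 = D u" "m' 14 = H u" "m' 15 = L u"
      using regs D u' by (auto simp: I_def frame_def regs_def arr_def)
    show "wp (block count_body) 23 (\<lambda>m tp. I (Suc j) m tp \<and> (0 < m 12) = (Suc j < Suc u)) m' tp'"
      using j r
      by (intro wp_block, unfold count_body_def wp_instrs_append)
        (simp_all add: I_def frame_def wp_add_dist one_minus_nat del: sum_of_bool_eq)
  next
    fix m' tp assume "I (Suc u) m' tp"
    then show "R m' tp" using post by (simp add: I_def del: sum.lessThan_Suc sum_of_bool_eq)
  qed (use t u in auto)
qed

section \<open>First pass: data of all vertices\<close>

definition deg :: "(nat \<Rightarrow> nat \<Rightarrow> nat) \<Rightarrow> nat \<Rightarrow> nat \<Rightarrow> nat" where
  "deg M n u = (\<Sum>v<n. M u v)"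

definition hi :: "(nat \<Rightarrow> nat \<Rightarrow> nat) \<Rightarrow> nat \<Rightarrow> nat \<Rightarrow> nat" where
  "hi M n u = acc_max (\<lambda>v. M u v * v) n"

definition lo :: "(nat \<Rightarrow> nat \<Rightarrow> nat) \<Rightarrow> nat \<Rightarrow> nat \<Rightarrow> nat" where
  "lo M n u = n - acc_max (\<lambda>v. M u v * (n - v)) n"

text \<open>
  A vertex w of degree 2 is the second twin of its pair iff exactly two vertices up to w, one of them w
  itself, have the same degree and the same least and greatest neighbour.
\<close>

definition rep :: "(nat \<Rightarrow> nat \<Rightarrow> nat) \<Rightarrow> nat \<Rightarrow> nat \<Rightarrow> nat" where
  "rep M n u = of_bool (deg M n u = 2 \<and>
     (\<Sum>w<Suc u. of_bool (deg M n w = deg M n u \<and> hi M n w = hi M n u \<and> lo M n w = lo M n u)) = (2 :: nat))"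

text \<open>A vertex of degree 1 has its only neighbour as its greatest one, so each such vertex
  among the first \<open>j\<close> clears the flag of the support it witnesses.\<close>

definition live :: "(nat \<Rightarrow> nat \<Rightarrow> nat) \<Rightarrow> nat \<Rightarrow> (nat \<Rightarrow> nat) \<Rightarrow> nat \<Rightarrow> nat \<Rightarrow> nat" where
  "live M n a j x = a x - (\<Sum>w<j. of_bool (deg M n w = 1 \<and> hi M n w = x))"

lemma acc_max_less: "(\<And>v. v < n \<Longrightarrow> f v < b) \<Longrightarrow> 0 < b \<Longrightarrow> acc_max f n < b"
proof (induction n)
  case (Suc n)
  then have "acc_max f n < b" "f n < b" by simp_all
  then show ?case by simp
qed simp

text \<open>The amount subtracted from the flag of the greatest neighbour is 1 - (d - 1) for the
  degree d; as d is positive, it is 1 for d = 1 and 0 otherwise.\<close>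

definition store_row :: "instr list" where
  "store_row = [Sub 15 24 15, Add 16 4 10, Store 16 13, Add 16 5 10, Store 16 14, Add 16 6 10, Store 16 15,
     Sub 18 13 2, Sub 18 2 18, Add 16 3 14, Load 17 16, Sub 17 17 18, Store 16 17]"

definition store_rep :: "instr list" where
  "store_rep = [Const 23 0, Const 21 2] @ add_dist 17 21 @ add_dist 13 21 @
     [Sub 18 2 23, Add 16 7 10, Store 16 18, Add 10 10 2, Sub 12 24 10]"

definition analyse :: code where
  "analyse = block [Add 9 8 20, Const 10 0] ;;
     do_while (scan_row ;; block store_row ;; count_same ;; block store_rep) 12"

lemma wp_analyse:
  assumes regs: "regs n m" and M: "\<And>u. u < n \<Longrightarrow> arr m (30 + 5 * n + u * n) n (M u)"
    and bit: "\<And>u v. M u v \<le> 1" and deg: "\<And>u. u < n \<Longrightarrow> 0 < deg M n u" and a: "arr m 30 n a"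
    and t: "n * (39 * n + 40) + 2 \<le> t"
    and post: "\<And>m'. frame ({9..19} \<union> {21, 23} \<union> {30..<30 + 5 * n}) m m' \<Longrightarrow>
      arr m' 30 n (live M n a n) \<Longrightarrow> arr m' (30 + n) n (deg M n) \<Longrightarrow>
      arr m' (30 + 2 * n) n (hi M n) \<Longrightarrow> arr m' (30 + 3 * n) n (lo M n) \<Longrightarrow>
      arr m' (30 + 4 * n) n (rep M n) \<Longrightarrow> R m' tp"
  shows "wp analyse t R m tp"
proof -
  let ?X = "{9..19} \<union> {21, 23} \<union> {30..<30 + 5 * n}"
  \<comment> \<open>The representative flags are left out because, within an iteration, they lag one
    row behind the other arrays.\<close>
  define S where "S = (\<lambda>j m'. frame ?X m m' \<and> arr m' 30 n (live M n a j) \<and>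
    arr m' (30 + n) j (deg M n) \<and> arr m' (30 + 2 * n) j (hi M n) \<and> arr m' (30 + 3 * n) j (lo M n) \<and>
    m' 9 = 30 + 5 * n + j * n)"
  define I where "I = (\<lambda>j m' tp'. S j m' \<and> arr m' (30 + 4 * n) j (rep M n) \<and> m' 10 = j \<and> tp' = tp)"
  have regs': "regs n m'" if "frame ?X m m'" for m'
    using regs that by (simp add: regs_def frame_def)
  have n: "0 < n" using regs by (simp add: regs_def)
  show ?thesis
    unfolding analyse_def
  proof (rule wp_block_seq[where t = "n * (39 * n + 40)"], simp,
      rule wp_do_while[where I = I and N = n and t = "39 * n + 39"])
    show "I 0 (m(9 := m 8 + m 20, 10 := 0)) tp"
      using regs a by (simp add: I_def S_def arr_def frame_def regs_def live_def)
    fix j m' tp' assume j: "j < n" "I j m' tp'"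
    \<comment> \<open>This keeps the flag that \<open>store_row\<close> updates inside the first
      array.\<close>
    have hi: "hi M n j < n" unfolding hi_def
    proof (rule acc_max_less)
      show "M j v * v < n" if "v < n" for v
        using bit[of j v] that by (cases "M j v") auto
    qed (rule n)
    define Q1 where "Q1 = (\<lambda>m1 (tp1 :: nat list). frame ?X m m1 \<and> arr m1 30 n (live M n a j) \<and>
      arr m1 (30 + n) j (deg M n) \<and> arr m1 (30 + 2 * n) j (hi M n) \<and> arr m1 (30 + 3 * n) j (lo M n) \<and>
      m1 9 = 30 + 5 * n + Suc j * n \<and> m1 13 = deg M n j \<and> m1 14 = hi M n j \<and> n - m1 15 = lo M n j \<and>
      arr m1 (30 + 4 * n) j (rep M n) \<and> m1 10 = j \<and> tp1 = tp)"
    define Q2 where "Q2 = (\<lambda>m1 (tp1 :: nat list). S (Suc j) m1 \<and>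
      m1 13 = deg M n j \<and> m1 14 = hi M n j \<and> m1 15 = lo M n j \<and>
      arr m1 (30 + 4 * n) j (rep M n) \<and> m1 10 = j \<and> tp1 = tp)"
    define Q3 where "Q3 = (\<lambda>m1 (tp1 :: nat list). S (Suc j) m1 \<and> m1 13 = deg M n j \<and>
      rep M n j = of_bool (deg M n j = 2 \<and> m1 17 = 2) \<and>
      arr m1 (30 + 4 * n) j (rep M n) \<and> m1 10 = j \<and> tp1 = tp)"
    have X: "frame ?X m m'" using j by (simp add: I_def S_def)
    have 1: "wp scan_row (15 * n + 5) Q1 m' tp'"
    proof (rule wp_scan_row[OF regs'[OF X], where b = "30 + 5 * n + j * n" and f = "M j"])
      show "arr m' (30 + 5 * n + j * n) n (M j)"
        using M[OF j(1)] X by (simp add: arr_def frame_def)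
    next
      fix m1 assume fr: "frame {9, 11, 12, 13, 14, 15, 16, 17, 18, 21} m' m1"
        and "m1 9 = 30 + 5 * n + j * n + n" "m1 13 = (\<Sum>v<n. M j v)" "m1 14 = acc_max (\<lambda>v. M j v * v) n"
        "m1 15 = acc_max (\<lambda>v. M j v * (n - v)) n"
      moreover have "frame ?X m m1" using fr by (rule frame_trans[OF X]) auto
      moreover have "m1 10 = j" using fr j by (simp add: frame_def I_def)
      moreover have "arr m1 b k f" if "arr m' b k f" "30 \<le> b" for b k f
        using that fr by (rule_tac arr_frame) auto
      ultimately show "Q1 m1 tp'"
        using j by (simp add: Q1_def I_def S_def deg_def hi_def lo_def)
    qed (use j bit in \<open>auto simp: I_def S_def\<close>)
    have 2: "wp (block store_row) 13 Q2 m1 tp1" if "Q1 m1 tp1" for m1 tp1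
    proof -
      have r: "m1 24 = n" "m1 4 = 30 + n" "m1 5 = 30 + 2 * n" "m1 6 = 30 + 3 * n" "m1 3 = 30" "m1 2 = 1"
        using that regs'[of m1] by (auto simp: Q1_def regs_def)
      have l: "live M n a (Suc j) x =
        live M n a j x - (if x = hi M n j then 1 - (deg M n j - 1) else 0)" for x
        using deg[OF j(1)] by (auto simp: live_def simp del: sum_of_bool_eq)
      show ?thesis
        using that r hi j(1)
        by (intro wp_block)
          (auto simp: store_row_def Q1_def Q2_def S_def frame_def arr_def less_Suc_eq l)
    qed
    have 3: "wp count_same (24 * n + 3) Q3 m1 tp1" if "Q2 m1 tp1" for m1 tp1
    proof (rule wp_count_same[where n = n and u = j and D = "deg M n" and H = "hi M n" and L = "lo M n"])
      show "regs n m1" using that regs'[of m1] by (simp add: Q2_def S_def)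
    next
      fix m2 assume fr: "frame {11, 12, 16, 17, 18, 19, 21, 23} m1 m2"
        and "m2 17 = (\<Sum>w<Suc j. of_bool (deg M n w = deg M n j \<and> hi M n w = hi M n j \<and> lo M n w = lo M n j))"
      moreover have "frame ?X m m2" using that fr by (intro frame_trans[OF _ fr]) (auto simp: Q2_def S_def)
      moreover have "m2 9 = m1 9" "m2 10 = m1 10" "m2 13 = m1 13" using fr by (simp_all add: frame_def)
      moreover have "arr m2 b k f" if "arr m1 b k f" "30 \<le> b" for b k f
        using that fr by (rule_tac arr_frame) auto
      ultimately show "Q3 m2 tp1"
        using that by (simp add: Q2_def Q3_def S_def rep_def del: sum_of_bool_eq sum.lessThan_Suc)
    qed (use that j in \<open>auto simp: Q2_def S_def\<close>)
    have 4: "wp (block store_rep) 15 (\<lambda>m tp. I (Suc j) m tp \<and> (0 < m 12) = (Suc j < n)) m1 tp1"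
      if "Q3 m1 tp1" for m1 tp1
    proof -
      have r: "m1 24 = n" "m1 7 = 30 + 4 * n" "m1 2 = 1"
        using that regs'[of m1] by (auto simp: Q3_def S_def regs_def)
      show ?thesis
        using that r j(1)
        by (intro wp_block, unfold store_rep_def wp_instrs_append)
          (simp_all add: wp_add_dist one_minus_nat Q3_def I_def S_def frame_upd arr_upd arr_Suc, blast)
    qed
    show "wp (scan_row ;; block store_row ;; count_same ;; block store_rep) (39 * n + 39)
      (\<lambda>m tp. I (Suc j) m tp \<and> (0 < m 12) = (Suc j < n)) m' tp'"
      by (rule wp_seq[OF 1 wp_seq[OF 2 wp_seq[OF 3 4 order.refl] order.refl]]) simp_all
  next
    fix m' tp assume "I n m' tp"
    then show "R m' tp" using post by (simp add: I_def S_def)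
  qed (use t n in auto)
qed

section \<open>Second pass: comparing two counts at every vertex\<close>

definition pairs_body :: "instr list" where
  "pairs_body = [Load 16 15, Add 17 3 11, Load 17 17, Add 16 16 17, Sub 16 16 2, Add 21 13 20,
     Add 17 16 22, Load 18 17, Add 14 14 18, Add 13 13 16, Add 15 15 2, Add 11 11 2, Sub 12 12 2]"

definition count_pairs :: code where
  "count_pairs = block [Const 13 0, Const 14 0, Const 11 0, Add 12 24 20, Add 15 9 20] ;;
     do_while (block pairs_body) 12"

text \<open>A pair is counted when its larger member is met, by adding the number of candidates seen
  before; one linear scan thus counts quadratically many pairs. The conjunction of two bits is their
  sum minus 1.\<close>

lemma wp_count_pairs:
  assumes regs: "regs n m" and b: "m 9 = b" "30 \<le> b" and f: "arr m b n f" "\<And>v. f v \<le> 1"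
    and l: "arr m 30 n l" "\<And>v. l v \<le> 1"
    and t: "14 * n + 5 \<le> t"
    and post: "\<And>m'. frame {11, 12, 13, 14, 15, 16, 17, 18, 21} m m' \<Longrightarrow>
      m' 14 = (\<Sum>v<n. f v * l v * (\<Sum>u<v. f u * l u)) \<Longrightarrow> R m' tp"
  shows "wp count_pairs t R m tp"
proof -
  define I where "I = (\<lambda>j m' tp'. frame {11, 12, 13, 14, 15, 16, 17, 18, 21} m m' \<and>
    m' 15 = b + j \<and> m' 11 = j \<and> m' 12 = n - j \<and> m' 13 = (\<Sum>v<j. f v * l v) \<and>
    m' 14 = (\<Sum>v<j. f v * l v * (\<Sum>u<v. f u * l u)) \<and> tp' = tp)"
  show ?thesis
    unfolding count_pairs_def
  proof (rule wp_block_seq[where t = "14 * n"], simp, rule wp_do_while[where I = I and N = n and t = 13])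
    show "I 0 (m(13 := 0, 14 := 0, 11 := 0, 12 := m 24 + m 20, 15 := m 9 + m 20)) tp"
      using regs b by (simp add: I_def arr_def frame_def regs_def)
    show "0 < n" using regs by (simp add: regs_def)
    fix j m' tp' assume j: "j < n" "I j m' tp'"
    then have r: "m' 2 = 1" "m' 20 = 0" "m' 22 = 20" "m' 3 = 30" "m' (b + j) = f j" "m' (30 + j) = l j"
      using b regs f(1) l(1) by (auto simp: I_def frame_def regs_def arr_def)
    have "f j = 0 \<or> f j = 1" "l j = 0 \<or> l j = 1" using f(2)[of j] l(2)[of j] by linarith+
    then show "wp (block pairs_body) 13 (\<lambda>m tp. I (Suc j) m tp \<and> (0 < m 12) = (Suc j < n)) m' tp'"
      using j r by (elim disjE; intro wp_block) (simp_all add: I_def frame_def pairs_body_def)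
  next
    fix m' tp assume "I n m' tp"
    then show "R m' tp" using post by (simp add: I_def)
  qed (use t in auto)
qed

text \<open>The sum of five bits minus 4, truncated at 0, is their conjunction.\<close>

definition twins_body :: "instr list" where
  "twins_body = [Add 16 7 11, Load 19 16,
     Add 16 5 11, Load 17 16, Add 16 9 17, Load 18 16, Add 19 19 18, Add 16 3 17, Load 18 16, Add 19 19 18,
     Add 16 6 11, Load 17 16, Add 16 9 17, Load 18 16, Add 19 19 18, Add 16 3 17, Load 18 16, Add 19 19 18,
     Const 18 4, Sub 19 19 18, Add 13 13 19, Add 11 11 2, Sub 12 12 2]"

definition count_twins :: code where
  "count_twins = block [Const 13 0, Const 11 0, Add 12 24 20] ;; do_while (block twins_body) 12"

lemma wp_count_twins:
  assumes regs: "regs n m" and b: "m 9 = b" "30 \<le> b" and f: "arr m b n f" "\<And>v. f v \<le> 1"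
    and l: "arr m 30 n l" "\<And>v. l v \<le> 1" and r: "arr m (30 + 4 * n) n r" "\<And>v. r v \<le> 1"
    and H: "arr m (30 + 2 * n) n H" "\<And>w. w < n \<Longrightarrow> H w < n"
    and L: "arr m (30 + 3 * n) n L" "\<And>w. w < n \<Longrightarrow> L w < n"
    and t: "24 * n + 3 \<le> t"
    and post: "\<And>m'. frame {11, 12, 13, 16, 17, 18, 19} m m' \<Longrightarrow>
      m' 13 = (\<Sum>w<n. r w * (f (H w) * l (H w)) * (f (L w) * l (L w))) \<Longrightarrow> R m' tp"
  shows "wp count_twins t R m tp"
proof -
  define I where "I = (\<lambda>j m' tp'. frame {11, 12, 13, 16, 17, 18, 19} m m' \<and>
    m' 11 = j \<and> m' 12 = n - j \<and>
    m' 13 = (\<Sum>w<j. r w * (f (H w) * l (H w)) * (f (L w) * l (L w))) \<and> tp' = tp)"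
  show ?thesis
    unfolding count_twins_def
  proof (rule wp_block_seq[where t = "24 * n"], simp, rule wp_do_while[where I = I and N = n and t = 23])
    show "I 0 (m(13 := 0, 11 := 0, 12 := m 24 + m 20)) tp"
      using regs by (simp add: I_def arr_def frame_def regs_def)
    show "0 < n" using regs by (simp add: regs_def)
    fix j m' tp' assume j: "j < n" "I j m' tp'"
    have "frame {11, 12, 13, 16, 17, 18, 19} m m'" using j by (simp add: I_def)
    then have m': "m' 2 = 1" "m' 3 = 30" "m' 5 = 30 + 2 * n" "m' 6 = 30 + 3 * n" "m' 7 = 30 + 4 * n" "m' 9 = b"
      "m' (30 + 4 * n + j) = r j" "m' (30 + 2 * n + j) = H j" "m' (30 + 3 * n + j) = L j"
      "m' (b + H j) = f (H j)" "m' (b + L j) = f (L j)" "m' (30 + H j) = l (H j)" "m' (30 + L j) = l (L j)"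
      using b regs r(1) f(1) l(1) H L j(1) by (auto simp: frame_def regs_def arr_def)
    \<comment> \<open>Row entries lie above the scratch registers, so the body does not overwrite
      what it is about to load.\<close>
    have b': "b + x \<noteq> 16" "b + x \<noteq> 17" "b + x \<noteq> 18" "b + x \<noteq> 19" for x
      using b(2) by simp_all
    have bits: "x = 0 \<or> x = 1" if "x \<le> 1" for x :: nat using that by linarith
    have "r j + f (H j) + l (H j) + f (L j) + l (L j) - 4 =
      r j * (f (H j) * l (H j)) * (f (L j) * l (L j))"
      using bits[OF r(2)[of j]] bits[OF f(2)[of "H j"]] bits[OF f(2)[of "L j"]]
        bits[OF l(2)[of "H j"]] bits[OF l(2)[of "L j"]]
      by (elim disjE) simp_all
    then show "wp (block twins_body) 23 (\<lambda>m tp. I (Suc j) m tp \<and> (0 < m 12) = (Suc j < n)) m' tp'"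
      using j m' b' by (intro wp_block) (simp_all add: I_def frame_def twins_body_def)
  next
    fix m' tp assume "I n m' tp"
    then show "R m' tp" using post by (simp add: I_def)
  qed (use t in auto)
qed

text \<open>Failures at the single vertices are added up in register 0 instead of leaving the loop
  early; the last instruction turns the sum 0 into the answer 1 and any other sum into 0.\<close>

definition check :: code where
  "check = block [Add 9 8 20, Const 10 0, Const 0 0] ;;
     do_while (count_pairs ;; count_twins ;;
       block [Sub 14 14 13, Add 0 0 14, Add 9 9 24, Add 10 10 2, Sub 12 24 10]) 12 ;;
     block [Sub 0 2 0]"

lemma wp_check:
  assumes regs: "regs n m" and M: "\<And>u. u < n \<Longrightarrow> arr m (30 + 5 * n + u * n) n (M u)" "\<And>u v. M u v \<le> 1"
    and l: "arr m 30 n l" "\<And>v. l v \<le> 1" and r: "arr m (30 + 4 * n) n r" "\<And>v. r v \<le> 1"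
    and H: "arr m (30 + 2 * n) n H" "\<And>w. w < n \<Longrightarrow> H w < n"
    and L: "arr m (30 + 3 * n) n L" "\<And>w. w < n \<Longrightarrow> L w < n"
    and t: "n * (38 * n + 14) + 4 \<le> t"
    and post: "\<And>m'. m' 0 = 1 - (\<Sum>z<n. (\<Sum>v<n. M z v * l v * (\<Sum>u<v. M z u * l u)) -
      (\<Sum>w<n. r w * (M z (H w) * l (H w)) * (M z (L w) * l (L w)))) \<Longrightarrow> R m' tp"
  shows "wp check t R m tp"
proof -
  let ?X = "{0} \<union> {9..19} \<union> {21}"
  define T where "T = (\<lambda>z. \<Sum>v<n. M z v * l v * (\<Sum>u<v. M z u * l u))"
  define C where "C = (\<lambda>z. \<Sum>w<n. r w * (M z (H w) * l (H w)) * (M z (L w) * l (L w)))"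
  define I where "I = (\<lambda>j m' tp'. frame ?X m m' \<and> m' 10 = j \<and> m' 9 = 30 + 5 * n + j * n \<and>
    m' 0 = (\<Sum>z<j. T z - C z) \<and> tp' = tp)"
  have n: "0 < n" using regs by (simp add: regs_def)
  show ?thesis
    unfolding check_def
  proof (rule wp_block_seq[where t = "n * (38 * n + 14) + 1"], simp, rule wp_seq',
      rule wp_do_while[where I = I and N = n and t = "38 * n + 13"])
    show "I 0 (m(9 := m 8 + m 20, 10 := 0, 0 := 0)) tp"
      using regs by (simp add: I_def frame_def regs_def)
    fix j m' tp' assume j: "j < n" "I j m' tp'"
    define Q1 where "Q1 = (\<lambda>m1 tp1. I j m1 tp1 \<and> m1 14 = T j)"
    define Q2 where "Q2 = (\<lambda>m1 tp1. I j m1 tp1 \<and> m1 14 = T j \<and> m1 13 = C j)"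
    have keep: "regs n m1" "arr m1 (30 + 5 * n + j * n) n (M j)" "arr m1 30 n l"
      "arr m1 (30 + 4 * n) n r" "arr m1 (30 + 2 * n) n H" "arr m1 (30 + 3 * n) n L"
      "m1 9 = 30 + 5 * n + j * n" if "I j m1 tp1" for m1 tp1
    proof -
      have fr: "frame ?X m m1" using that by (simp add: I_def)
      show "regs n m1" using fr by (rule regs_frame[OF regs]) simp
      have "arr m1 b k f" if "arr m b k f" "30 \<le> b" for b k f
        using that fr by (rule_tac arr_frame) auto
      then show "arr m1 (30 + 5 * n + j * n) n (M j)" "arr m1 30 n l" "arr m1 (30 + 4 * n) n r"
        "arr m1 (30 + 2 * n) n H" "arr m1 (30 + 3 * n) n L"
        using M(1)[OF j(1)] l(1) r(1) H(1) L(1) by simp_all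
    qed (use that in \<open>simp add: I_def\<close>)
    have 1: "wp count_pairs (14 * n + 5) Q1 m' tp'"
    proof (rule wp_count_pairs[where b = "30 + 5 * n + j * n" and f = "M j" and l = l,
          OF keep(1)[OF j(2)] keep(7)[OF j(2)] _ keep(2)[OF j(2)] M(2) keep(3)[OF j(2)] l(2)])
      fix m1 assume fr: "frame {11, 12, 13, 14, 15, 16, 17, 18, 21} m' m1"
        and "m1 14 = (\<Sum>v<n. M j v * l v * (\<Sum>u<v. M j u * l u))"
      moreover have "frame ?X m m1" using j(2) fr by (intro frame_trans[OF _ fr]) (auto simp: I_def)
      moreover have "m1 0 = m' 0" "m1 9 = m' 9" "m1 10 = m' 10" using fr by (simp_all add: frame_def)
      ultimately show "Q1 m1 tp'" using j(2) by (simp add: Q1_def I_def T_def)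
    qed simp_all
    have 2: "wp count_twins (24 * n + 3) Q2 m1 tp1" if Q1: "Q1 m1 tp1" for m1 tp1
    proof -
      have I: "I j m1 tp1" using Q1 by (simp add: Q1_def)
      show ?thesis
      proof (rule wp_count_twins[where b = "30 + 5 * n + j * n" and f = "M j" and l = l,
          OF keep(1)[OF I] keep(7)[OF I] _ keep(2)[OF I] M(2) keep(3)[OF I] l(2) keep(4)[OF I] r(2)
            keep(5)[OF I] H(2) keep(6)[OF I] L(2)])
        fix m2 assume fr: "frame {11, 12, 13, 16, 17, 18, 19} m1 m2"
          and "m2 13 = (\<Sum>w<n. r w * (M j (H w) * l (H w)) * (M j (L w) * l (L w)))"
        moreover have "frame ?X m m2" using I fr by (intro frame_trans[OF _ fr]) (auto simp: I_def)
        moreover have "m2 0 = m1 0" "m2 9 = m1 9" "m2 10 = m1 10" "m2 14 = m1 14"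
          using fr by (simp_all add: frame_def)
        ultimately show "Q2 m2 tp1" using Q1 by (simp add: Q1_def Q2_def I_def C_def)
      qed simp_all
    qed
    have 3: "wp (block [Sub 14 14 13, Add 0 0 14, Add 9 9 24, Add 10 10 2, Sub 12 24 10]) 5
      (\<lambda>m tp. I (Suc j) m tp \<and> (0 < m 12) = (Suc j < n)) m1 tp1" if "Q2 m1 tp1" for m1 tp1
      using that keep(1)[of m1 tp1]
      by (intro wp_block) (auto simp: Q2_def I_def frame_def regs_def)
    show "wp (count_pairs ;; count_twins ;;
        block [Sub 14 14 13, Add 0 0 14, Add 9 9 24, Add 10 10 2, Sub 12 24 10]) (38 * n + 13)
      (\<lambda>m tp. I (Suc j) m tp \<and> (0 < m 12) = (Suc j < n)) m' tp'"
      by (rule wp_seq[OF 1 wp_seq[OF 2 3 order.refl]]) simp_all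
  next
    fix m' tp' assume "I n m' tp'"
    then show "wp (block [Sub 0 2 0]) 1 R m' tp'"
      using regs post[of "m'(0 := m' 2 - m' 0)"]
      by (intro wp_block) (auto simp: I_def frame_def regs_def T_def C_def)
  qed (use t n in auto)
qed


section \<open>What the algorithm computes\<close>

lemma acc_max_upper: "v < n \<Longrightarrow> f v \<le> acc_max f n"
proof (induction n)
  case (Suc n)
  then show ?case by (cases "v = n") (auto intro: le_trans)
qed simp

lemma acc_max_attained: "acc_max f n = 0 \<or> (\<exists>v<n. acc_max f n = f v)"
proof (induction n)
  case (Suc n)
  show ?case
  proof (cases "f n \<le> acc_max f n")
    case True
    then show ?thesis using Suc by (auto intro: less_SucI)
  next
    case False
    then show ?thesis by (auto intro: exI[of _ n])
  qed
qed simp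

text \<open>A neighbourhood of size 2 can be recovered from its least and greatest element, so two
  such neighbourhoods are compared in constant time instead of row by row.\<close>

lemma card_2_Min_Max:
  fixes S :: "nat set"
  assumes "card S = 2"
  shows "S = {Min S, Max S}" "Min S < Max S"
proof -
  obtain x y where "S = {x, y}" "x \<noteq> y" using assms by (auto simp: card_2_iff)
  then show "S = {Min S, Max S}" "Min S < Max S" by (auto simp: min_def max_def)
qed

text \<open>The witness is the second smallest element; it will be the canonical representative of a
  pair with twins.\<close>

lemma two_le_card_iff_second:
  fixes S :: "nat set"
  assumes "finite S"
  shows "2 \<le> card S \<longleftrightarrow> (\<exists>w \<in> S. card {v \<in> S. v \<le> w} = 2)"
proof
  assume "2 \<le> card S"
  then have "S \<noteq> {}" by auto
  define x where "x = Min S"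
  have x: "x \<in> S" "\<And>v. v \<in> S \<Longrightarrow> x \<le> v" using assms \<open>S \<noteq> {}\<close> by (auto simp: x_def)
  have "S - {x} \<noteq> {}"
  proof
    assume "S - {x} = {}"
    then have "S \<subseteq> {x}" by auto
    then have "card S \<le> card {x}" by (intro card_mono) auto
    then show False using \<open>2 \<le> card S\<close> by simp
  qed
  define y where "y = Min (S - {x})"
  have "y \<in> S - {x}" unfolding y_def using assms \<open>S - {x} \<noteq> {}\<close> by (intro Min_in) auto
  moreover have "y \<le> v" if "v \<in> S" "v \<noteq> x" for v
    unfolding y_def using assms that by (intro Min_le) auto
  ultimately have "{v \<in> S. v \<le> y} = {x, y}" using x by force
  moreover have "x \<noteq> y" using \<open>y \<in> S - {x}\<close> by auto
  ultimately show "\<exists>w \<in> S. card {v \<in> S. v \<le> w} = 2" using \<open>y \<in> S - {x}\<close> by (intro bexI[of _ y]) auto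
next
  assume "\<exists>w \<in> S. card {v \<in> S. v \<le> w} = 2"
  then obtain w where "card {v \<in> S. v \<le> w} = 2" by blast
  moreover have "card {v \<in> S. v \<le> w} \<le> card S" using assms by (intro card_mono) auto
  ultimately show "2 \<le> card S" by simp
qed

text \<open>Initial segments of \<open>S\<close> ending at different elements of \<open>S\<close>
  are strictly nested and hence differ in size.\<close>

lemma second_unique:
  fixes S :: "nat set"
  assumes "card {v \<in> S. v \<le> w} = 2" "card {v \<in> S. v \<le> w'} = 2" "w \<in> S" "w' \<in> S"
  shows "w = w'"
proof -
  have *: False if "w1 < w2" "w2 \<in> S" "card {v \<in> S. v \<le> w1} = 2" "card {v \<in> S. v \<le> w2} = 2" for w1 w2
  proof -
    have "w2 \<in> {v \<in> S. v \<le> w2} - {v \<in> S. v \<le> w1}" using that by simp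
    moreover have "{v \<in> S. v \<le> w1} \<subseteq> {v \<in> S. v \<le> w2}" using that by auto
    ultimately have "{v \<in> S. v \<le> w1} \<subset> {v \<in> S. v \<le> w2}" by blast
    then have "card {v \<in> S. v \<le> w1} < card {v \<in> S. v \<le> w2}" by (intro psubset_card_mono) auto
    then show False using that by simp
  qed
  show ?thesis using *[of w w'] *[of w' w] assms by (cases w w' rule: linorder_cases) auto
qed

locale nonisolated_rel =
  fixes E :: "(nat \<times> nat) set" and n :: nat and A :: "nat set"
  assumes E: "E \<subseteq> {..<n} \<times> {..<n}" and nbrs_nonempty: "\<And>u. u < n \<Longrightarrow> nbrs E u \<noteq> {}" and A: "A \<subseteq> {..<n}"
begin

abbreviation M :: "nat \<Rightarrow> nat \<Rightarrow> nat" where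
  "M u v \<equiv> of_bool (v \<in> nbrs E u)"

lemma nbrs_less: "v \<in> nbrs E u \<Longrightarrow> v < n" "v \<in> nbrs E u \<Longrightarrow> u < n"
  using E by (auto simp: nbrs_def)

lemma finite_nbrs: "finite (nbrs E u)"
  using nbrs_less(1) by (meson finite_nat_iff_bounded lessThan_iff subsetI)

lemma deg_eq: "deg M n u = card (nbrs E u)"
proof -
  have "{..<n} \<inter> nbrs E u = nbrs E u" using nbrs_less by auto
  then show ?thesis by (simp add: deg_def)
qed

lemma hi_eq:
  assumes "u < n"
  shows "hi M n u = Max (nbrs E u)"
proof (rule Max_eqI[symmetric])
  obtain v where v: "v \<in> nbrs E u" using nbrs_nonempty[OF assms] by auto
  show upper: "w \<le> hi M n u" if "w \<in> nbrs E u" for w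
    using acc_max_upper[of w n "\<lambda>v. M u v * v"] that nbrs_less(1)[OF that] by (simp add: hi_def)
  show "hi M n u \<in> nbrs E u"
    \<comment> \<open>The value 0 is also the default of an empty maximum. Here it bounds the
      neighbour \<open>v\<close> from above, so \<open>v\<close> is the vertex 0 and 0 is a genuine
      neighbour.\<close>
    using acc_max_attained[of "\<lambda>v. M u v * v" n] upper[OF v] v
    by (cases "hi M n u = 0") (auto simp: hi_def split: if_splits)
qed (rule finite_nbrs)

lemma lo_eq:
  assumes "u < n"
  shows "lo M n u = Min (nbrs E u)"
proof -
  let ?f = "\<lambda>v. M u v * (n - v)"
  obtain v where v: "v \<in> nbrs E u" using nbrs_nonempty[OF assms] by auto
  have upper: "n - w \<le> acc_max ?f n" if "w \<in> nbrs E u" for w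
    using acc_max_upper[of w n ?f] that nbrs_less(1)[OF that] by simp
  \<comment> \<open>Neighbours contribute positive values, so the maximum is attained at a neighbour
    and is not the default.\<close>
  have "0 < acc_max ?f n" using upper[OF v] nbrs_less(1)[OF v] by simp
  then obtain w where w: "w < n" "acc_max ?f n = ?f w"
    using acc_max_attained[of ?f n] by auto
  then have "w \<in> nbrs E u" using \<open>0 < acc_max ?f n\<close> by (auto split: if_splits)
  then have "lo M n u = w" using w by (simp add: lo_def)
  moreover have "w \<le> v" if "v \<in> nbrs E u" for v
    using upper[OF that] w \<open>w \<in> nbrs E u\<close> nbrs_less(1)[OF that] by simp
  ultimately show ?thesis using \<open>w \<in> nbrs E u\<close> finite_nbrs by (metis Min_eqI)
qed

definition core :: "nat set" where
  "core = {x \<in> A. \<not> support E x}"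

text \<open>Subtracting from a bit the number of degree-1 vertices attached to \<open>x\<close>
  clears it exactly if there is one, that is, if \<open>x\<close> is a support.\<close>

lemma live_eq: "live M n (\<lambda>v. of_bool (v \<in> A)) n x = of_bool (x \<in> core)"
proof -
  have "deg M n w = 1 \<and> hi M n w = x \<longleftrightarrow> nbrs E w = {x}" if "w < n" for w
  proof
    assume "deg M n w = 1 \<and> hi M n w = x"
    then have "card (nbrs E w) = 1" and Max: "Max (nbrs E w) = x" using that by (simp_all add: deg_eq hi_eq)
    then obtain y where "nbrs E w = {y}" by (elim card_1_singletonE)
    with Max show "nbrs E w = {x}" by simp
  qed (use that in \<open>simp add: deg_eq hi_eq\<close>)
  then have "{..<n} \<inter> {w. deg M n w = 1 \<and> hi M n w = x} = {w. nbrs E w = {x}}"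
    using nbrs_less(2) by blast
  then have live: "live M n (\<lambda>v. of_bool (v \<in> A)) n x = of_bool (x \<in> A) - card {w. nbrs E w = {x}}"
    by (simp add: live_def)
  have fin: "finite {w. nbrs E w = {x}}"
    by (rule finite_subset[of _ "{..<n}"]) (use nbrs_less(2) in auto)
  show ?thesis
  proof (cases "support E x")
    case True
    then have "card {w. nbrs E w = {x}} \<noteq> 0" using fin by (auto simp: support_def)
    then have "1 \<le> card {w. nbrs E w = {x}}" by simp
    then show ?thesis using True by (simp add: live core_def)
  next
    case False
    then have "{w. nbrs E w = {x}} = {}" by (auto simp: support_def)
    then show ?thesis using False by (simp add: live core_def)
  qed
qed

definition second :: "nat \<Rightarrow> bool" where
  "second u \<longleftrightarrow> card (nbrs E u) = 2 \<and> card {w. nbrs E w = nbrs E u \<and> w \<le> u} = 2"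

lemma rep_eq:
  assumes "u < n"
  shows "rep M n u = of_bool (second u)"
proof (cases "card (nbrs E u) = 2")
  case True
  define same where
    "same = (\<lambda>w. deg M n w = deg M n u \<and> hi M n w = hi M n u \<and> lo M n w = lo M n u)"
  have same: "same w \<longleftrightarrow> nbrs E w = nbrs E u" if "w < Suc u" for w
  proof -
    have "w < n" using that assms by simp
    then show ?thesis
      using True assms card_2_Min_Max(1)[of "nbrs E w"] card_2_Min_Max(1)[of "nbrs E u"]
      by (auto simp: same_def deg_eq hi_eq lo_eq)
  qed
  have "{..<Suc u} \<inter> {w. same w} = {w. nbrs E w = nbrs E u \<and> w \<le> u}"
    using same by auto
  then show ?thesis
    by (simp add: rep_def second_def same_def deg_eq del: sum.lessThan_Suc)
qed (simp add: rep_def second_def deg_eq)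

lemma twin_pair_iff_second:
  assumes "u < v"
  shows "twin_pair E u v \<longleftrightarrow> (\<exists>w. nbrs E w = {u, v} \<and> second w)"
proof -
  let ?S = "{w. nbrs E w = {u, v}}"
  have fin: "finite ?S" by (rule finite_subset[of _ "{..<n}"]) (use nbrs_less(2) in auto)
  have "twin_pair E u v \<longleftrightarrow> 2 \<le> card ?S"
  proof
    assume "twin_pair E u v"
    then obtain w w' where "w \<noteq> w'" "{w, w'} \<subseteq> ?S" by (auto simp: twin_pair_def)
    then show "2 \<le> card ?S" using card_mono[OF fin, of "{w, w'}"] by simp
  next
    assume "2 \<le> card ?S"
    then obtain w w' where "w \<in> ?S" "w' \<in> ?S" "w \<noteq> w'"
      by (metis card_le_Suc0_iff_eq fin not_less_eq_eq numeral_2_eq_2)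
    then show "twin_pair E u v" by (auto simp: twin_pair_def)
  qed
  also have "\<dots> \<longleftrightarrow> (\<exists>w. nbrs E w = {u, v} \<and> second w)"
    unfolding two_le_card_iff_second[OF fin] using assms by (auto simp: second_def)
  finally show ?thesis .
qed

text \<open>Each unordered pair occurs once, larger member first, in agreement with the scan and
  with the order greatest, least neighbour of a representative.\<close>

definition pairs :: "nat \<Rightarrow> (nat \<times> nat) set" where
  "pairs z = (SIGMA v : nbrs E z \<inter> core. nbrs E z \<inter> core \<inter> {..<v})"

lemma finite_pairs: "finite (pairs z)"
  using finite_nbrs by (auto simp: pairs_def)

lemma sum_pairs:
  "(\<Sum>v<n. M z v * of_bool (v \<in> core) * (\<Sum>u<v. M z u * of_bool (u \<in> core))) = card (pairs z)"
proof -
  let ?K = "nbrs E z \<inter> core"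
  have "(\<Sum>v<n. M z v * of_bool (v \<in> core) * (\<Sum>u<v. M z u * of_bool (u \<in> core))) =
      (\<Sum>v<n. if v \<in> ?K then card (?K \<inter> {..<v}) else 0)"
    by (intro sum.cong) (auto simp: Int_def conj_commute simp flip: of_bool_conj)
  also have "\<dots> = (\<Sum>v \<in> ?K. card (?K \<inter> {..<v}))"
    by (rule sum.mono_neutral_cong_right) (use nbrs_less in auto)
  also have "\<dots> = card (pairs z)"
    unfolding pairs_def using finite_nbrs by (subst card_SigmaI) auto
  finally show ?thesis .
qed

text \<open>The map from \<open>w\<close> to its greatest and least neighbour is a bijection from
  the representatives counted at \<open>z\<close> onto the pairs at \<open>z\<close> with twins. It
  is injective because the two values determine the neighbourhood and a neighbourhood has only one
  second vertex.\<close>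

lemma sum_seconds:
  "(\<Sum>w<n. rep M n w * (M z (hi M n w) * of_bool (hi M n w \<in> core)) *
      (M z (lo M n w) * of_bool (lo M n w \<in> core))) =
    card {(v, u) \<in> pairs z. twin_pair E u v}"
proof -
  let ?h = "\<lambda>w. (Max (nbrs E w), Min (nbrs E w))"
  let ?W = "{w. w < n \<and> second w \<and> Max (nbrs E w) \<in> nbrs E z \<inter> core \<and> Min (nbrs E w) \<in> nbrs E z \<inter> core}"
  have second: "nbrs E w = {Min (nbrs E w), Max (nbrs E w)}" "Min (nbrs E w) < Max (nbrs E w)" if "second w" for w
    using card_2_Min_Max[of "nbrs E w"] that by (auto simp: second_def)
  have "(\<Sum>w<n. rep M n w * (M z (hi M n w) * of_bool (hi M n w \<in> core)) *
      (M z (lo M n w) * of_bool (lo M n w \<in> core))) =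
      (\<Sum>w<n. of_bool (w \<in> ?W))"
    by (intro sum.cong) (auto simp: rep_eq hi_eq lo_eq)
  also have "\<dots> = card ({..<n} \<inter> {w. w \<in> ?W})"
    by (simp only: sum_of_bool_eq finite_lessThan of_nat_id)
  also have "{..<n} \<inter> {w. w \<in> ?W} = ?W" by auto
  also have "card ?W = card (?h ` ?W)"
  proof (rule card_image[symmetric], rule inj_onI)
    fix w w' assume w: "w \<in> ?W" "w' \<in> ?W" and "?h w = ?h w'"
    then have "nbrs E w = nbrs E w'" using second(1)[of w] second(1)[of w'] by auto
    then show "w = w'"
      using w second_unique[of "{v. nbrs E v = nbrs E w}" w w'] by (auto simp: second_def)
  qed
  also have "?h ` ?W = {(v, u) \<in> pairs z. twin_pair E u v}"
  proof (intro equalityI subsetI)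
    fix x assume "x \<in> ?h ` ?W"
    then obtain w where w: "w \<in> ?W" "x = ?h w" by blast
    then have "twin_pair E (Min (nbrs E w)) (Max (nbrs E w))"
      using second[of w] twin_pair_iff_second by blast
    then show "x \<in> {(v, u) \<in> pairs z. twin_pair E u v}"
      using w second(2)[of w] by (auto simp: pairs_def)
  next
    fix x assume "x \<in> {(v, u) \<in> pairs z. twin_pair E u v}"
    then obtain u v where x: "x = (v, u)" "(v, u) \<in> pairs z" "twin_pair E u v" by auto
    then have "u < v" by (auto simp: pairs_def)
    then obtain w where w: "nbrs E w = {u, v}" "second w" using twin_pair_iff_second x by blast
    then have "Max (nbrs E w) = v" "Min (nbrs E w) = u" using \<open>u < v\<close> by auto
    moreover have "w < n" using nbrs_less(2)[of u w] w by auto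
    ultimately have "w \<in> ?W" "x = ?h w" using x w by (auto simp: pairs_def)
    then show "x \<in> ?h ` ?W" by blast
  qed
  finally show ?thesis .
qed

lemma twinned_iff: "twinned E A \<longleftrightarrow> (\<forall>z<n. \<forall>(v, u) \<in> pairs z. twin_pair E u v)"
proof
  assume "twinned E A"
  then show "\<forall>z<n. \<forall>(v, u) \<in> pairs z. twin_pair E u v"
    by (fastforce simp: twinned_def pairs_def core_def)
next
  assume *: "\<forall>z<n. \<forall>(v, u) \<in> pairs z. twin_pair E u v"
  have sym: "twin_pair E x y = twin_pair E y x" for x y
    by (simp add: twin_pair_def insert_commute)
  have **: "twin_pair E u v" if "u < v" "u \<in> nbrs E z \<inter> A" "v \<in> nbrs E z \<inter> A" "\<not> support E u" "\<not> support E v"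
    for u v z
  proof -
    have "(v, u) \<in> pairs z" "z < n" using that nbrs_less(2) by (auto simp: pairs_def core_def)
    then show ?thesis using * by blast
  qed
  show "twinned E A"
    unfolding twinned_def
  proof (intro allI ballI impI)
    fix z x y assume "x \<in> nbrs E z \<inter> A" "y \<in> nbrs E z \<inter> A" "\<not> support E x" "\<not> support E y" "x \<noteq> y"
    then show "twin_pair E x y"
      using **[of x y z] **[of y x z] sym[of x y] by (cases x y rule: linorder_cases) auto
  qed
qed

text \<open>The pairs with twins form a subset of the finite set of pairs at \<open>z\<close>, so
  truncation hides nothing: the difference of sizes is 0 only if the subset is everything.\<close>

lemma answer_eq:
  "1 - (\<Sum>z<n. (\<Sum>v<n. M z v * of_bool (v \<in> core) * (\<Sum>u<v. M z u * of_bool (u \<in> core))) -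
      (\<Sum>w<n. rep M n w * (M z (hi M n w) * of_bool (hi M n w \<in> core)) *
        (M z (lo M n w) * of_bool (lo M n w \<in> core)))) = (if twinned E A then 1 else (0 :: nat))"
proof -
  have "card (pairs z) - card {(v, u) \<in> pairs z. twin_pair E u v} = 0 \<longleftrightarrow>
      (\<forall>(v, u) \<in> pairs z. twin_pair E u v)" for z
  proof
    assume "card (pairs z) - card {(v, u) \<in> pairs z. twin_pair E u v} = 0"
    then have "{(v, u) \<in> pairs z. twin_pair E u v} = pairs z"
      using finite_pairs by (intro card_seteq) auto
    then show "\<forall>(v, u) \<in> pairs z. twin_pair E u v" by blast
  next
    assume "\<forall>(v, u) \<in> pairs z. twin_pair E u v"
    then have "{(v, u) \<in> pairs z. twin_pair E u v} = pairs z" by auto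
    then show "card (pairs z) - card {(v, u) \<in> pairs z. twin_pair E u v} = 0" by simp
  qed
  then have "(\<Sum>z<n. card (pairs z) - card {(v, u) \<in> pairs z. twin_pair E u v}) = 0 \<longleftrightarrow> twinned E A"
    by (simp add: twinned_iff Ball_def)
  then show ?thesis unfolding sum_pairs sum_seconds by (auto simp del: sum_eq_0_iff)
qed

end


section \<open>Reading the two input formats\<close>

text \<open>The common target of both readers, after which the input format no longer
  matters.\<close>

definition loaded :: "nat \<Rightarrow> (nat \<Rightarrow> nat \<Rightarrow> nat) \<Rightarrow> (nat \<Rightarrow> nat) \<Rightarrow> (nat \<Rightarrow> nat) \<Rightarrow> bool" where
  "loaded n M a m \<longleftrightarrow>
     regs n m \<and> arr m 30 n a \<and> (\<forall>u<n. arr m (30 + 5 * n + u * n) n (M u))"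

definition read_header :: code where
  "read_header = block [Read 24, Const 2 1, Const 22 20, Const 3 30, Add 4 3 24, Add 5 4 24, Add 6 5 24,
     Add 7 6 24, Add 8 7 24, Add 9 3 20] ;; read_row ;; block [Add 9 8 20, Add 10 24 20]"

text \<open>That the matrix area is still zero is recorded for the list reader, which writes only
  ones.\<close>

lemma wp_read_header:
  assumes n: "0 < n" and t: "5 * n + 13 \<le> t"
    and post: "\<And>m. regs n m \<Longrightarrow> arr m 30 n a \<Longrightarrow> \<forall>x \<ge> 30 + 5 * n. m x = 0 \<Longrightarrow>
      m 9 = 30 + 5 * n \<Longrightarrow> m 10 = n \<Longrightarrow> R m rest"
  shows "wp read_header t R (\<lambda>_. 0) (n # map a [0..<n] @ rest)"
  unfolding read_header_def
proof (rule wp_block_seq[where t = "5 * n + 3"])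
  let ?m = "(\<lambda>_. 0)(24 := n, 2 := 1, 22 := 20, 3 := 30, 4 := 30 + n, 5 := 30 + n + n, 6 := 30 + n + n + n,
    7 := 30 + n + n + n + n, 8 := 30 + n + n + n + n + n, 9 := 30)"
  have regs: "regs n ?m" using n by (simp add: regs_def)
  have "wp (read_row ;; block [Add 9 8 20, Add 10 24 20]) (5 * n + 3) R ?m (map a [0..<n] @ rest)"
  proof (rule wp_seq', rule wp_read_row[OF regs _ _ _ order.refl, where b = 30])
    fix m' assume m': "arr m' 30 n (nth (map a [0..<n]))" "m' 9 = 30 + n"
      and fr: "frame ({9, 12, 16} \<union> {30..<30 + n}) ?m m'"
    have regs': "regs n m'" by (rule regs_frame[OF regs fr]) simp
    have zero: "m' x = 0" if "30 + 5 * n \<le> x" for x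
      using fr that unfolding frame_def by simp
    have "arr m' 30 n a" using m'(1) by (simp add: arr_def)
    then have "R (m'(9 := m' 8 + m' 20, 10 := m' 24 + m' 20)) rest"
      using regs' zero by (intro post) (simp_all add: regs_def arr_upd)
    then show "wp (block [Add 9 8 20, Add 10 24 20]) 2 R m' rest"
      by (intro wp_block) simp_all
  qed simp_all
  then show "wp_instrs [Read 24, Const 2 1, Const 22 20, Const 3 30, Add 4 3 24, Add 5 4 24, Add 6 5 24,
     Add 7 6 24, Add 8 7 24, Add 9 3 20] (wp (read_row ;; block [Add 9 8 20, Add 10 24 20]) (5 * n + 3) R)
     (\<lambda>_. 0) (n # map a [0..<n] @ rest)"
    by simp
qed (use t in simp)

section \<open>Adjacency matrix\<close>

definition read_matrix :: code where
  "read_matrix = do_while (read_row ;; block [Sub 10 10 2]) 10"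

lemma wp_read_matrix:
  assumes m: "regs n m" "arr m 30 n a" "m 9 = 30 + 5 * n" "m 10 = n" and t: "n * (5 * n + 3) \<le> t"
    and post: "\<And>m'. loaded n M a m' \<Longrightarrow> R m' []"
  shows "wp read_matrix t R m (concat (map (\<lambda>u. map (M u) [0..<n]) [0..<n]))"
  unfolding read_matrix_def
proof -
  define I where "I = (\<lambda>j m' tp. regs n m' \<and> arr m' 30 n a \<and>
    (\<forall>u<j. arr m' (30 + 5 * n + u * n) n (M u)) \<and> m' 9 = 30 + 5 * n + j * n \<and> m' 10 = n - j \<and>
    tp = concat (map (\<lambda>u. map (M u) [0..<n]) [j..<n]))"
  show "wp (do_while (read_row ;; block [Sub 10 10 2]) 10) t R m
    (concat (map (\<lambda>u. map (M u) [0..<n]) [0..<n]))"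
  proof (rule wp_do_while[where I = I and N = n and t = "5 * n + 2"])
    show "I 0 m (concat (map (\<lambda>u. map (M u) [0..<n]) [0..<n]))" using m by (simp add: I_def)
    show "0 < n" using m by (simp add: regs_def)
    fix j m' tp assume j: "j < n" and I: "I j m' tp"
    let ?b = "30 + 5 * n + j * n"
    have tp: "tp = map (M j) [0..<n] @ concat (map (\<lambda>u. map (M u) [0..<n]) [Suc j..<n])"
      using I j by (simp add: I_def upt_conv_Cons)
    have regs: "regs n m'" and b: "m' 9 = ?b" using I by (simp_all add: I_def)
    show "wp (read_row ;; block [Sub 10 10 2]) (5 * n + 2)
      (\<lambda>m tp. I (Suc j) m tp \<and> (0 < m 10) = (Suc j < n)) m' tp"
      unfolding tp
    proof (rule wp_seq', rule wp_read_row[OF regs b _ _ order.refl])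
      fix m1 assume m1: "arr m1 ?b n (nth (map (M j) [0..<n]))" "m1 9 = ?b + n"
        and fr: "frame ({9, 12, 16} \<union> {?b..<?b + n}) m' m1"
      have regs1: "regs n m1" by (rule regs_frame[OF regs fr]) simp
      have "arr m1 (30 + 5 * n + u * n) n (M u)" if "u < Suc j" for u
      proof (cases "u = j")
        case True
        then show ?thesis using m1(1) by (simp add: arr_def)
      next
        case False
        \<comment> \<open>Row \<open>u\<close> ends where row \<open>Suc u\<close> begins, hence not
          after the start of the row being written.\<close>
        then have "Suc u * n \<le> j * n" using that by (intro mult_le_mono1) simp
        moreover have "arr m' (30 + 5 * n + u * n) n (M u)" using I that False by (simp add: I_def)
        ultimately show ?thesis using fr by (elim arr_frame) auto
      qed
      moreover have "arr m1 30 n a"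
        using I fr unfolding I_def by (elim arr_frame conjE) auto
      moreover have "m1 10 = n - j" using fr I by (simp add: frame_def I_def)
      ultimately show "wp (block [Sub 10 10 2]) 1
        (\<lambda>m tp. I (Suc j) m tp \<and> (0 < m 10) = (Suc j < n)) m1
        (concat (map (\<lambda>u. map (M u) [0..<n]) [Suc j..<n]))"
        using regs1 m1(2) j by (intro wp_block) (simp_all add: I_def regs_def arr_upd)
    qed simp_all
  next
    fix m' tp assume "I n m' tp"
    then show "R m' tp" using post by (simp add: I_def loaded_def)
  qed (use t in \<open>simp_all add: algebra_simps\<close>)
qed

section \<open>Adjacency lists\<close>

definition mark_row :: code where
  "mark_row = block [Read 12] ;; do_while (block [Read 16, Add 16 16 9, Store 16 2, Sub 12 12 2]) 12"

text \<open>A list becomes a row by marking the listed positions in a zeroed area, so the order of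
  its elements is immaterial. It must be nonempty because the loop tests after its body.\<close>

lemma wp_mark_row:
  assumes "m 2 = 1" and b: "m 9 = b" "30 \<le> b" and zero: "arr m b n (\<lambda>_. 0)"
    and ws: "ws \<noteq> []" "\<And>w. w \<in> set ws \<Longrightarrow> w < n" and t: "5 * length ws + 1 \<le> t"
    and post: "\<And>m'. frame ({12, 16} \<union> {b..<b + n}) m m' \<Longrightarrow>
      arr m' b n (\<lambda>v. of_bool (v \<in> set ws)) \<Longrightarrow> R m' rest"
  shows "wp mark_row t R m (length ws # ws @ rest)"
proof -
  define I where "I = (\<lambda>j m' tp. frame ({12, 16} \<union> {b..<b + n}) m m' \<and> m' 12 = length ws - j \<and>
    arr m' b n (\<lambda>v. of_bool (v \<in> set (take j ws))) \<and> tp = drop j ws @ rest)"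
  show ?thesis
    unfolding mark_row_def
  proof (rule wp_block_seq[where t = "5 * length ws"], simp,
      rule wp_do_while[where I = I and N = "length ws" and t = 4])
    have "frame ({12, 16} \<union> {b..<b + n}) m (m(12 := length ws))" by (simp add: frame_def)
    then show "I 0 (m(12 := length ws)) (ws @ rest)"
      using zero b by (simp add: I_def arr_upd)
    show "0 < length ws" using ws by simp
    fix j m' tp assume j: "j < length ws" "I j m' tp"
    then have tp: "tp = ws ! j # (drop (Suc j) ws @ rest)"
      by (simp add: I_def Cons_nth_drop_Suc)
    have r: "m' 2 = 1" "m' 9 = b" using j b assms(1) by (simp_all add: I_def frame_def)
    have w: "ws ! j < n" using ws(2) j(1) by simp
    let ?m = "m'(16 := b + ws ! j, b + ws ! j := 1, 12 := m' 12 - 1)"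
    have "frame ({12, 16} \<union> {b..<b + n}) m ?m"
      using j w by (intro frame_upd) (auto simp: I_def)
    moreover have "arr ?m b n (\<lambda>v. of_bool (v \<in> set (take (Suc j) ws)))"
      using j b w by (auto simp: I_def arr_def take_Suc_conv_app_nth)
    ultimately have "I (Suc j) ?m (drop (Suc j) ws @ rest)"
      using j b by (simp add: I_def)
    moreover have "?m 12 = length ws - Suc j" using j by (simp add: I_def)
    moreover have "16 \<noteq> b + ws ! j" using b by simp
    ultimately show "wp (block [Read 16, Add 16 16 9, Store 16 2, Sub 12 12 2]) 4
      (\<lambda>m tp. I (Suc j) m tp \<and> (0 < m 12) = (Suc j < length ws)) m' tp"
      unfolding tp using r b j by (intro wp_block) (auto simp: add.commute)
  next
    fix m' tp assume "I (length ws) m' tp"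
    then show "R m' tp" using post by (simp add: I_def)
  qed (use t in simp_all)
qed

definition read_lists :: code where
  "read_lists = do_while (mark_row ;; block [Add 9 9 24, Sub 10 10 2]) 10"

lemma wp_read_lists:
  assumes m: "regs n m" "arr m 30 n a" "\<forall>x \<ge> 30 + 5 * n. m x = 0" "m 9 = 30 + 5 * n" "m 10 = n"
    and adj: "length adj = n" "\<And>u. u < n \<Longrightarrow> distinct (adj ! u) \<and> adj ! u \<noteq> [] \<and> set (adj ! u) \<subseteq> {..<n}"
    and M: "\<And>u. u < n \<Longrightarrow> M u = (\<lambda>v. of_bool (v \<in> set (adj ! u)))"
    and t: "n * (5 * n + 4) \<le> t"
    and post: "\<And>m'. loaded n M a m' \<Longrightarrow> R m' []"
  shows "wp read_lists t R m (concat (map (\<lambda>ws. length ws # ws) adj))"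
proof -
  define I where "I = (\<lambda>j m' tp. regs n m' \<and> arr m' 30 n a \<and> (\<forall>x \<ge> 30 + 5 * n + j * n. m' x = 0) \<and>
    (\<forall>u<j. arr m' (30 + 5 * n + u * n) n (M u)) \<and> m' 9 = 30 + 5 * n + j * n \<and> m' 10 = n - j \<and>
    tp = concat (map (\<lambda>ws. length ws # ws) (drop j adj)))"
  show ?thesis
    unfolding read_lists_def
  proof (rule wp_do_while[where I = I and N = n and t = "5 * n + 3"])
    show "I 0 m (concat (map (\<lambda>ws. length ws # ws) adj))" using m by (simp add: I_def)
    show "0 < n" using m by (simp add: regs_def)
    fix j m' tp assume j: "j < n" and I: "I j m' tp"
    let ?b = "30 + 5 * n + j * n" and ?ws = "adj ! j"
    have tp: "tp = length ?ws # ?ws @ concat (map (\<lambda>ws. length ws # ws) (drop (Suc j) adj))"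
      using I j adj(1) by (simp add: I_def flip: Cons_nth_drop_Suc)
    \<comment> \<open>Distinctness bounds the list by n, so reading one list takes linear
      time.\<close>
    have "length ?ws \<le> n"
      using adj(2)[OF j] card_mono[of "{..<n}" "set ?ws"] by (simp add: distinct_card)
    show "wp (mark_row ;; block [Add 9 9 24, Sub 10 10 2]) (5 * n + 3)
      (\<lambda>m tp. I (Suc j) m tp \<and> (0 < m 10) = (Suc j < n)) m' tp"
      unfolding tp
    proof (rule wp_seq', rule wp_mark_row[where b = ?b and n = n])
      show "m' 2 = 1" "m' 9 = ?b" "arr m' ?b n (\<lambda>_. 0)"
        using I by (simp_all add: I_def regs_def arr_def)
      show "?ws \<noteq> []" "\<And>w. w \<in> set ?ws \<Longrightarrow> w < n" using adj(2)[OF j] by auto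
      show "5 * length ?ws + 1 \<le> 5 * n + 1" using \<open>length ?ws \<le> n\<close> by simp
      fix m1 assume fr: "frame ({12, 16} \<union> {?b..<?b + n}) m' m1"
        and m1: "arr m1 ?b n (\<lambda>v. of_bool (v \<in> set ?ws))"
      have regs1: "regs n m1" using I fr unfolding I_def by (elim conjE) (rule regs_frame, auto)
      have "arr m1 (30 + 5 * n + u * n) n (M u)" if "u < Suc j" for u
      proof (cases "u = j")
        case True
        then show ?thesis using m1 M[OF j] by simp
      next
        case False
        then have "Suc u * n \<le> j * n" using that by (intro mult_le_mono1) simp
        moreover have "arr m' (30 + 5 * n + u * n) n (M u)" using I that False by (simp add: I_def)
        ultimately show ?thesis using fr by (elim arr_frame) auto
      qed
      moreover have "arr m1 30 n a"
        using I fr unfolding I_def by (elim arr_frame conjE) auto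
      moreover have "m1 10 = n - j" "m1 9 = ?b" using fr I by (simp_all add: frame_def I_def)
      moreover have "m1 x = 0" if "?b + n \<le> x" for x
        using fr I that by (simp add: frame_def I_def)
      ultimately show "wp (block [Add 9 9 24, Sub 10 10 2]) 2
        (\<lambda>m tp. I (Suc j) m tp \<and> (0 < m 10) = (Suc j < n)) m1
        (concat (map (\<lambda>ws. length ws # ws) (drop (Suc j) adj)))"
        using regs1 j by (intro wp_block) (simp_all add: I_def regs_def arr_upd)
    qed simp_all
  next
    fix m' tp assume "I n m' tp"
    then show "R m' tp" using post adj(1) by (simp add: I_def loaded_def)
  qed (use t in \<open>simp_all add: algebra_simps\<close>)
qed


section \<open>The decision procedure\<close>

lemma wp_analyse_check:
  assumes "nonisolated_rel E n A" and m: "loaded n (\<lambda>u v. of_bool (v \<in> nbrs E u)) (\<lambda>v. of_bool (v \<in> A)) m"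
    and t: "77 * n * n + 54 * n + 6 \<le> t"
  shows "wp (analyse ;; check) t (\<lambda>m _. m 0 = (if twinned E A then 1 else 0)) m tp"
proof -
  interpret nonisolated_rel E n A by fact
  have regs: "regs n m" and arrM: "\<And>u. u < n \<Longrightarrow> arr m (30 + 5 * n + u * n) n (M u)"
    and a: "arr m 30 n (\<lambda>v. of_bool (v \<in> A))"
    using m by (auto simp: loaded_def)
  have bit: "\<And>u v. M u v \<le> 1" by simp
  have deg: "0 < deg M n u" if "u < n" for u
    using nbrs_nonempty[OF that] finite_nbrs by (simp add: deg_eq card_gt_0_iff)
  show ?thesis
  proof (rule wp_seq', rule wp_analyse[OF regs arrM bit deg a order.refl])
    fix m' assume fr: "frame ({9..19} \<union> {21, 23} \<union> {30..<30 + 5 * n}) m m'"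
      and l: "arr m' 30 n (live M n (\<lambda>v. of_bool (v \<in> A)) n)"
      and HL: "arr m' (30 + 2 * n) n (hi M n)" "arr m' (30 + 3 * n) n (lo M n)"
      and r: "arr m' (30 + 4 * n) n (rep M n)"
    have l': "arr m' 30 n (\<lambda>x. of_bool (x \<in> core))"
      using l by (simp add: arr_def live_eq)
    have arrM': "arr m' (30 + 5 * n + u * n) n (M u)" if "u < n" for u
      using arrM[OF that] fr by (rule arr_frame) auto
    show "wp check (n * (38 * n + 14) + 4) (\<lambda>m _. m 0 = (if twinned E A then 1 else 0)) m' tp"
    proof (rule wp_check[OF _ arrM' bit l' _ r _ HL(1) _ HL(2) _ order.refl])
      show "regs n m'" by (rule regs_frame[OF regs fr]) simp
      show "hi M n w < n" "lo M n w < n" if "w < n" for w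
        using nbrs_less(1) Max_in[OF finite_nbrs nbrs_nonempty[OF that]] Min_in[OF finite_nbrs nbrs_nonempty[OF that]] that
        by (auto simp: hi_eq lo_eq)
      show "rep M n v \<le> 1" for v by (simp add: rep_def)
      fix m1 :: "nat \<Rightarrow> nat"
      assume "m1 0 = 1 - (\<Sum>z<n. (\<Sum>v<n. M z v * of_bool (v \<in> core) * (\<Sum>u<v. M z u * of_bool (u \<in> core))) -
        (\<Sum>w<n. rep M n w * (M z (hi M n w) * of_bool (hi M n w \<in> core)) *
          (M z (lo M n w) * of_bool (lo M n w \<in> core))))"
      then show "m1 0 = (if twinned E A then 1 else 0)" by (rule trans[OF _ answer_eq])
    qed simp_all
  next
    show "n * (39 * n + 40) + 2 + (n * (38 * n + 14) + 4) \<le> t"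
      using t by (simp add: algebra_simps)
  qed
qed

definition solver :: "code \<Rightarrow> instr list" where
  "solver reader = (read_header ;; reader ;; analyse ;; check) 0"

lemma answers_withinI:
  assumes "wp c t (\<lambda>m _. m 0 = (if b then 1 else 0)) (\<lambda>_. 0) inp"
  shows "answers_within (c 0) inp b t"
proof -
  obtain k s' where "k \<le> t" "(step ([] @ c (length []) @ []) ^^ k) (initial inp) = s'"
    "pc s' = length [] + length (c (length []))" "mem s' 0 = (if b then 1 else 0)"
    using wpE[of c t "\<lambda>m _. m 0 = (if b then 1 else 0)" "initial inp" "[]" "[]"] assms
    by (auto simp: initial_def)
  then show ?thesis unfolding answers_within_def halted_def by auto
qed

text \<open>The reader is a parameter, specified for arbitrary postconditions so that it fits into
  sequential composition. The bound adds 5n + 13 for the header, n(5n + 4) for the edges and 77n^2 +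
  54n + 6 for the two passes.\<close>

lemma solver_correct:
  fixes G :: "nat pair_pre_digraph"
  assumes G: "pair_graph G" "pverts G = {..<n}" "Digraph_Component.connected (with_proj G)"
    and bip: "bipartition G A B" and card: "1 \<le> card A" "card A \<le> card B"
    and reader: "\<And>m R. nonisolated_rel (parcs G) n A \<Longrightarrow> regs n m \<Longrightarrow> arr m 30 n (\<lambda>v. of_bool (v \<in> A)) \<Longrightarrow> \<forall>x \<ge> 30 + 5 * n. m x = 0 \<Longrightarrow>
      m 9 = 30 + 5 * n \<Longrightarrow> m 10 = n \<Longrightarrow>
      (\<And>m'. loaded n (\<lambda>u v. of_bool (v \<in> nbrs (parcs G) u)) (\<lambda>v. of_bool (v \<in> A)) m' \<Longrightarrow> R m' []) \<Longrightarrow>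
      wp reader (n * (5 * n + 4)) R m edges"
  shows "answers_within (solver reader) (header G A @ edges) (domination_number G = card A)
    (82 * n * n + 63 * n + 19)"
proof -
  interpret pair_graph G by fact
  have disj: "A \<inter> B = {}" and V: "A \<union> B = {..<n}"
    using bip G by (auto simp: bipartition_def)
  have "A \<noteq> {}" "B \<noteq> {}" using card by auto
  have nbrs: "nbrs (parcs G) u \<noteq> {}" if "u < n" for u
  proof -
    \<comment> \<open>Two disjoint nonempty sides provide a vertex other than \<open>u\<close>, as a
      path from \<open>u\<close> needs a different endpoint.\<close>
    obtain v where "v < n" "v \<noteq> u" using \<open>A \<noteq> {}\<close> \<open>B \<noteq> {}\<close> disj V by blast
    then show ?thesis using connected_nonisolated[OF G(1,3), of u v] that G(2) by (auto simp: nbrs_def)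
  qed
  have E: "parcs G \<subseteq> {..<n} \<times> {..<n}" using G(2) in_arcsD1 in_arcsD2 by fastforce
  have adj: "nonisolated_rel (parcs G) n A" using E nbrs V by unfold_locales auto
  have "bipartite_nonisolated G A B (parcs G)"
    using G(2) bip nbrs arcs_symmetric by unfold_locales auto
  then have iff: "domination_number G = card A \<longleftrightarrow> twinned (parcs G) A"
    by (rule bipartite_nonisolated.domination_number_eq_iff)
  have "0 < n" using \<open>A \<noteq> {}\<close> V by auto
  have header: "header G A = n # map (\<lambda>v. of_bool (v \<in> A)) [0..<n]"
    using G(2) by (simp add: header_def of_bool_def)
  have "wp (read_header ;; reader ;; analyse ;; check) (82 * n * n + 63 * n + 19)
    (\<lambda>m _. m 0 = (if twinned (parcs G) A then 1 else 0)) (\<lambda>_. 0) (header G A @ edges)"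
    unfolding header append_Cons
  proof (rule wp_seq', rule wp_read_header[OF \<open>0 < n\<close> order.refl], rule wp_seq', rule reader[OF adj])
    fix m' assume "loaded n (\<lambda>u v. of_bool (v \<in> nbrs (parcs G) u)) (\<lambda>v. of_bool (v \<in> A)) m'"
    then show "wp (analyse ;; check) (77 * n * n + 54 * n + 6)
      (\<lambda>m _. m 0 = (if twinned (parcs G) A then 1 else 0)) m' []"
      by (rule wp_analyse_check[OF adj _ order.refl])
  qed (assumption | rule order.refl | simp add: algebra_simps)+
  then show ?thesis unfolding solver_def iff by (rule answers_withinI)
qed

theorem theorem14:
  fixes input :: "nat pair_pre_digraph \<Rightarrow> nat set \<Rightarrow> nat list \<Rightarrow> bool"
  assumes "input = adjacency_lists_input \<or> input = matrix_input"
  shows "\<exists>(P :: instr list) (T :: nat \<Rightarrow> nat).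
           (\<lambda>n. real (T n)) \<in> O(\<lambda>n. (real n)\<^sup>2) \<and>
           (\<forall>(n :: nat) (G :: nat pair_pre_digraph) (A :: nat set) (B :: nat set) (inp :: nat list).
              pair_graph G \<longrightarrow> pverts G = {..<n} \<longrightarrow>
              Digraph_Component.connected (with_proj G) \<longrightarrow>
              bipartition G A B \<longrightarrow> 1 \<le> card A \<longrightarrow> card A \<le> card B \<longrightarrow>
              input G A inp \<longrightarrow>
              answers_within P inp (domination_number G = card A) (T n))"
proof -
  define T where "T = (\<lambda>n :: nat. 82 * n * n + 63 * n + 19)"
  have T: "(\<lambda>n. real (T n)) \<in> O(\<lambda>n. (real n)\<^sup>2)"
  \<comment> \<open>164 = 82 + 63 + 19, because n and 1 are at most n^2 for positive n.\<close>
  proof (rule bigoI[of _ 164])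
    have "real (T n) \<le> 164 * (real n)\<^sup>2" if "1 \<le> n" for n
    proof -
      have "n \<le> n * n" "1 \<le> n * n" using that by simp_all
      then have "T n \<le> 164 * (n * n)" unfolding T_def by linarith
      then have "real (T n) \<le> real (164 * (n * n))" by (simp only: of_nat_le_iff)
      then show ?thesis by (simp add: power2_eq_square)
    qed
    then show "\<forall>\<^sub>F n in sequentially. norm (real (T n)) \<le> 164 * norm ((real n)\<^sup>2)"
      by (intro eventually_sequentiallyI[of 1]) simp
  qed
  have "\<exists>P. \<forall>n G A B inp. pair_graph G \<longrightarrow> pverts G = {..<n} \<longrightarrow>
      Digraph_Component.connected (with_proj G) \<longrightarrow> bipartition G A B \<longrightarrow> 1 \<le> card A \<longrightarrow>
      card A \<le> card B \<longrightarrow> input G A inp \<longrightarrow>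
      answers_within P inp (domination_number G = card A) (T n)"
    using assms
  proof
    assume input: "input = adjacency_lists_input"
    show ?thesis
    proof (intro exI[of _ "solver read_lists"] allI impI)
      fix n G A B inp
      assume G: "pair_graph G" "pverts G = {..<n}" "Digraph_Component.connected (with_proj G)"
        "bipartition G A B" "1 \<le> card A" "card A \<le> card B" and inp: "input G A inp"
      then obtain adj where adj: "length adj = n"
        "\<And>v. v < n \<Longrightarrow> distinct (adj ! v) \<and> set (adj ! v) = nbrs (parcs G) v"
        "inp = header G A @ concat (map (\<lambda>ws. length ws # ws) adj)"
        by (auto simp: input adjacency_lists_input_def nbrs_def)
      show "answers_within (solver read_lists) inp (domination_number G = card A) (T n)"
        unfolding T_def adj(3)
      proof (rule solver_correct[OF G])
        fix m and R :: assertion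
        assume E: "nonisolated_rel (parcs G) n A"
          and m: "regs n m" "arr m 30 n (\<lambda>v. of_bool (v \<in> A))" "\<forall>x \<ge> 30 + 5 * n. m x = 0"
            "m 9 = 30 + 5 * n" "m 10 = n"
          and R: "\<And>m'. loaded n (\<lambda>u v. of_bool (v \<in> nbrs (parcs G) u)) (\<lambda>v. of_bool (v \<in> A)) m' \<Longrightarrow> R m' []"
        interpret nonisolated_rel "parcs G" n A by fact
        show "wp read_lists (n * (5 * n + 4)) R m (concat (map (\<lambda>ws. length ws # ws) adj))"
        proof (rule wp_read_lists[where M = M, OF m adj(1)])
          show "distinct (adj ! u) \<and> adj ! u \<noteq> [] \<and> set (adj ! u) \<subseteq> {..<n}" if "u < n" for u
            using adj(2)[OF that] nbrs_nonempty[OF that] nbrs_less(1) by auto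
          show "M u = (\<lambda>v. of_bool (v \<in> set (adj ! u)))" if "u < n" for u
            using adj(2)[OF that] by simp
        qed (simp_all add: R)
      qed
    qed
  next
    assume input: "input = matrix_input"
    show ?thesis
    proof (intro exI[of _ "solver read_matrix"] allI impI)
      fix n G A B inp
      assume G: "pair_graph G" "pverts G = {..<n}" "Digraph_Component.connected (with_proj G)"
        "bipartition G A B" "1 \<le> card A" "card A \<le> card B" and inp: "input G A inp"
      then have inp: "inp = header G A @
          concat (map (\<lambda>u. map (\<lambda>v. of_bool (v \<in> nbrs (parcs G) u)) [0..<n]) [0..<n])"
        by (simp add: input matrix_input_def nbrs_def of_bool_def)
      show "answers_within (solver read_matrix) inp (domination_number G = card A) (T n)"
        unfolding T_def inp
      proof (rule solver_correct[OF G])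
        fix m and R :: assertion
        assume m: "regs n m" "arr m 30 n (\<lambda>v. of_bool (v \<in> A))" "m 9 = 30 + 5 * n" "m 10 = n"
          and R: "\<And>m'. loaded n (\<lambda>u v. of_bool (v \<in> nbrs (parcs G) u)) (\<lambda>v. of_bool (v \<in> A)) m' \<Longrightarrow> R m' []"
        show "wp read_matrix (n * (5 * n + 4)) R m
            (concat (map (\<lambda>u. map (\<lambda>v. of_bool (v \<in> nbrs (parcs G) u)) [0..<n]) [0..<n]))"
          by (rule wp_read_matrix[where M = "\<lambda>u v. of_bool (v \<in> nbrs (parcs G) u)", OF m])
            (simp_all add: R algebra_simps)
      qed
    qed
  qed
  with T show ?thesis by blast
qed

end
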